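(* Let $f:[0,\infty)\to[0,\infty)$ be nondecreasing and lower semicontinuous with $f(s)\le Ks^p$ for all $s\ge0$, for some constants $K>0$, $p>0$. Let $\Omega\subset\mathbb{R}^n$ be a bounded open domain with slab diameter $d$, $c=d^2/8$, and let $h,\lambda\in L^\infty(\Omega)$ with $h\ge0$, $\lambda\ge0$, $\Lambda=\|\lambda\|_\infty$. Consider the problem $-\Delta u=\lambda(x)f(u)+h(x)$ in $\Omega$, $u=0$ on $\partial\Omega$. (i) If $p<1$, the problem has a weak solution $u\in W^{1,2}_0(\Omega)\cap L^\infty(\Omega)$, $u\ge0$. (ii) If $p\ge1$ and $cK\Lambda\le\frac12$ and $\|h\|_\infty\le\Lambda K$, the problem has a weak solution $u\in W^{1,2}_0(\Omega)\cap L^\infty(\Omega)$, $u\ge 0$, with $\|u\|_\infty\le1$.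
   Context: Standing assumption: domains are $C^{1,1}$. The slab diameter $d(\Omega)$ is the infimum of the distances between two parallel hyperplanes such that $\Omega$ lies in the region between them. A weak solution of $-\Delta u=\lambda f(u)+h$ in a bounded $\Omega$ with $u=0$ on $\partial\Omega$ is a $u\in W^{1,2}_0(\Omega)$ with $\int_\Omega\nabla u\cdot\nabla\varphi\,dx=\int_\Omega(\lambda f(u)+h)\varphi\,dx$ for all $\varphi\in C_c^\infty(\Omega)$. *)

theory Defs
  imports "HOL-Analysis.Analysis"
begin

fun iter_partial :: "'a::euclidean_space list \<Rightarrow> ('a \<Rightarrow> real) \<Rightarrow> 'a \<Rightarrow> real" where
  "iter_partial [] f = f"
| "iter_partial (d # ds) f = (\<lambda>x. frechet_derivative (iter_partial ds f) (at x) d)"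

definition smooth_fun :: "('a::euclidean_space \<Rightarrow> real) \<Rightarrow> bool" where
  "smooth_fun f \<longleftrightarrow> (\<forall>ds. set ds \<subseteq> Basis \<longrightarrow> (\<forall>x. iter_partial ds f differentiable (at x)))"

definition test_fun :: "'a::euclidean_space set \<Rightarrow> ('a \<Rightarrow> real) \<Rightarrow> bool" where
  "test_fun \<Omega> \<phi> \<longleftrightarrow> smooth_fun \<phi> \<and> compact (closure {x. \<phi> x \<noteq> 0}) \<and> closure {x. \<phi> x \<noteq> 0} \<subseteq> \<Omega>"

definition grad :: "('a::euclidean_space \<Rightarrow> real) \<Rightarrow> 'a \<Rightarrow> 'a" where
  "grad \<phi> x = (\<Sum>i\<in>Basis. frechet_derivative \<phi> (at x) i *\<^sub>R i)"

definition L2_on :: "'a::euclidean_space set \<Rightarrow> ('a \<Rightarrow> 'b::euclidean_space) \<Rightarrow> bool" where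
  "L2_on \<Omega> u \<longleftrightarrow> u \<in> borel_measurable (restrict_space lebesgue \<Omega>)
      \<and> set_integrable lebesgue \<Omega> (\<lambda>x. (norm (u x))\<^sup>2)"

definition Linf_on :: "'a::euclidean_space set \<Rightarrow> ('a \<Rightarrow> real) \<Rightarrow> bool" where
  "Linf_on \<Omega> u \<longleftrightarrow> u \<in> borel_measurable (restrict_space lebesgue \<Omega>)
      \<and> (\<exists>M. AE x in lebesgue. x \<in> \<Omega> \<longrightarrow> \<bar>u x\<bar> \<le> M)"

definition Linf_norm :: "'a::euclidean_space set \<Rightarrow> ('a \<Rightarrow> real) \<Rightarrow> real" where
  "Linf_norm \<Omega> u = Inf {M. AE x in lebesgue. x \<in> \<Omega> \<longrightarrow> \<bar>u x\<bar> \<le> M}"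

definition weak_grad :: "'a::euclidean_space set \<Rightarrow> ('a \<Rightarrow> real) \<Rightarrow> ('a \<Rightarrow> 'a) \<Rightarrow> bool" where
  "weak_grad \<Omega> u g \<longleftrightarrow>
     (\<forall>\<phi>. test_fun \<Omega> \<phi> \<longrightarrow>
        set_integrable lebesgue \<Omega> (\<lambda>x. u x *\<^sub>R grad \<phi> x)
      \<and> set_integrable lebesgue \<Omega> (\<lambda>x. \<phi> x *\<^sub>R g x)
      \<and> (LINT x:\<Omega>|lebesgue. u x *\<^sub>R grad \<phi> x) = - (LINT x:\<Omega>|lebesgue. \<phi> x *\<^sub>R g x))"

definition W120 :: "'a::euclidean_space set \<Rightarrow> ('a \<Rightarrow> real) \<Rightarrow> ('a \<Rightarrow> 'a) \<Rightarrow> bool" where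
  "W120 \<Omega> u g \<longleftrightarrow> L2_on \<Omega> u \<and> L2_on \<Omega> g \<and> weak_grad \<Omega> u g
     \<and> (\<exists>\<phi>s::nat \<Rightarrow> 'a \<Rightarrow> real. (\<forall>k. test_fun \<Omega> (\<phi>s k))
          \<and> (\<lambda>k. LINT x:\<Omega>|lebesgue. (\<phi>s k x - u x)\<^sup>2) \<longlonglongrightarrow> 0
          \<and> (\<lambda>k. LINT x:\<Omega>|lebesgue. (norm (grad (\<phi>s k) x - g x))\<^sup>2) \<longlonglongrightarrow> 0)"

definition weak_solution ::
  "'a::euclidean_space set \<Rightarrow> ('a \<Rightarrow> real) \<Rightarrow> (real \<Rightarrow> real) \<Rightarrow> ('a \<Rightarrow> real) \<Rightarrow> ('a \<Rightarrow> real) \<Rightarrow> bool" where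
  "weak_solution \<Omega> lam f h u \<longleftrightarrow>
     (\<exists>g. W120 \<Omega> u g \<and>
        (\<forall>\<phi>. test_fun \<Omega> \<phi> \<longrightarrow>
           set_integrable lebesgue \<Omega> (\<lambda>x. g x \<bullet> grad \<phi> x)
         \<and> set_integrable lebesgue \<Omega> (\<lambda>x. (lam x * f (u x) + h x) * \<phi> x)
         \<and> (LINT x:\<Omega>|lebesgue. g x \<bullet> grad \<phi> x)
             = (LINT x:\<Omega>|lebesgue. (lam x * f (u x) + h x) * \<phi> x)))"

definition slab_diam :: "'a::euclidean_space set \<Rightarrow> real" where
  "slab_diam \<Omega> = Inf {b2 - b1 | a b1 b2. norm a = 1 \<and> \<Omega> \<subseteq> {x. b1 \<le> a \<bullet> x \<and> a \<bullet> x \<le> b2}}"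

definition C11_fun :: "('a::euclidean_space \<Rightarrow> real) \<Rightarrow> bool" where
  "C11_fun \<gamma> \<longleftrightarrow> (\<forall>x. \<gamma> differentiable (at x))
     \<and> (\<exists>L. \<forall>y z. onorm (\<lambda>v. frechet_derivative \<gamma> (at y) v - frechet_derivative \<gamma> (at z) v) \<le> L * norm (y - z))"

(* C^{1,1} domain: near each boundary point, \<Omega> is the subgraph of a C^{1,1}
   function in suitable orthonormal coordinates (unit direction e, graph over e\<^sup>\<bottom>) *)
definition C11_domain :: "'a::euclidean_space set \<Rightarrow> bool" where
  "C11_domain \<Omega> \<longleftrightarrow> (\<forall>p\<in>frontier \<Omega>. \<exists>e r \<gamma>. norm e = 1 \<and> r > 0 \<and> C11_fun \<gamma> \<and>
       \<Omega> \<inter> ball p r = {x \<in> ball p r. e \<bullet> x < \<gamma> (x - (e \<bullet> x) *\<^sub>R e)})"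

definition lsc_nonneg :: "(real \<Rightarrow> real) \<Rightarrow> bool" where
  "lsc_nonneg f \<longleftrightarrow> (\<forall>s\<ge>0. \<forall>\<epsilon>>0. \<exists>\<delta>>0. \<forall>t\<ge>0. \<bar>t - s\<bar> < \<delta> \<longrightarrow> f s - \<epsilon> < f t)"

end

theory Submission
  imports Defs
begin

text \<open>
  The solution is the limit of the monotone iteration \<open>-\<Delta>u\<^sub>n\<^sub>+\<^sub>1 = \<lambda> f(u\<^sub>n) + h\<close> started at
  \<open>u\<^sub>0 = 0\<close>. Every linear problem is solved by minimising the Dirichlet energy over test
  functions. The iterates increase by the weak maximum principle, and they stay below a
  constant \<open>B\<close> by comparison with the quadratic barrier
  \<open>A/2 (b\<^sub>2 - a \<bullet> x)(a \<bullet> x - b\<^sub>1)\<close> of a slab containing the domain, as soon as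
  \<open>d\<^sup>2/8 (\<Lambda> f(B) + \<parallel>h\<parallel>) \<le> B\<close>. A nondecreasing lower semicontinuous \<open>f\<close> is left continuous, so
  \<open>f(u\<^sub>n)\<close> converges to \<open>f(u)\<close> along the increasing sequence, and the \<open>L\<^sup>2\<close> stability of the
  linear problem identifies the limit as a weak solution.

  Positive parts of test functions are replaced by the smooth function \<open>s exp(-\<epsilon>/s)\<close>, which
  vanishes for \<open>s \<le> 0\<close>, has slope between 0 and 1, and differs from \<open>s\<^sup>+\<close> by at most \<open>\<epsilon>\<close>;
  in this way all truncations are again test functions.
\<close>

section \<open>Smooth functions\<close>

primrec k_smooth :: "nat \<Rightarrow> ('a::euclidean_space \<Rightarrow> real) \<Rightarrow> bool" where
  "k_smooth 0 f \<longleftrightarrow> (\<forall>x. f differentiable (at x))"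
| "k_smooth (Suc k) f \<longleftrightarrow> (\<forall>x. f differentiable (at x)) \<and>
     (\<forall>i\<in>Basis. k_smooth k (\<lambda>x. frechet_derivative f (at x) i))"

lemma iter_partial_snoc:
  "iter_partial (ds @ [d]) f = iter_partial ds (\<lambda>x. frechet_derivative f (at x) d)"
  by (induction ds) auto

lemma k_smooth_iff_iter_partial:
  "k_smooth k f \<longleftrightarrow> (\<forall>ds. set ds \<subseteq> Basis \<and> length ds \<le> k \<longrightarrow>
     (\<forall>x. iter_partial ds f differentiable (at x)))"
proof (induction k arbitrary: f)
  case 0
  then show ?case by auto
next
  case (Suc k)
  show ?case
  proof (intro iffI allI impI)
    fix ds :: "'a list" and x
    assume f: "k_smooth (Suc k) f" and ds: "set ds \<subseteq> Basis \<and> length ds \<le> Suc k"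
    show "iter_partial ds f differentiable (at x)"
    proof (cases ds rule: rev_cases)
      case Nil
      then show ?thesis using f by simp
    next
      case (snoc es e)
      then have "k_smooth k (\<lambda>x. frechet_derivative f (at x) e)" using f ds by auto
      then show ?thesis using Suc.IH snoc ds by (simp add: iter_partial_snoc)
    qed
  next
    assume partials: "\<forall>ds. set ds \<subseteq> Basis \<and> length ds \<le> Suc k \<longrightarrow>
      (\<forall>x. iter_partial ds f differentiable (at x))"
    have "f differentiable (at x)" for x
      using partials[rule_format, of "[]"] by simp
    moreover have "k_smooth k (\<lambda>x. frechet_derivative f (at x) i)" if "i \<in> Basis" for i
      unfolding Suc.IH
    proof (intro allI impI)
      fix ds :: "'a list" and x assume "set ds \<subseteq> Basis \<and> length ds \<le> k"
      then show "iter_partial ds (\<lambda>x. frechet_derivative f (at x) i) differentiable (at x)"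
        using partials[rule_format, of "ds @ [i]" x] that by (simp add: iter_partial_snoc)
    qed
    ultimately show "k_smooth (Suc k) f" by simp
  qed
qed

lemma smooth_fun_iff_k_smooth: "smooth_fun f \<longleftrightarrow> (\<forall>k. k_smooth k f)"
  unfolding smooth_fun_def k_smooth_iff_iter_partial by blast

lemma k_smooth_SucD: "k_smooth (Suc k) f \<Longrightarrow> k_smooth k f"
  by (auto simp: k_smooth_iff_iter_partial)

lemma k_smooth_differentiable: "k_smooth k f \<Longrightarrow> f differentiable (at x)"
  by (cases k) auto

lemma frechet_derivative_at':
  "(f has_derivative f') (at x) \<Longrightarrow> frechet_derivative f (at x) = f'"
  by (rule frechet_derivative_at[symmetric])

lemma has_derivative_frechet_derivative:
  "f differentiable (at x) \<Longrightarrow> (f has_derivative frechet_derivative f (at x)) (at x)"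
  by (simp flip: frechet_derivative_works)

lemma k_smooth_const: "k_smooth k (\<lambda>x. c)"
  by (induction k arbitrary: c) auto

lemma k_smooth_inner: "k_smooth k (\<lambda>x. a \<bullet> x)"
proof (cases k)
  case (Suc l)
  have "((\<bullet>) a has_derivative (\<bullet>) a) (at x)" for x
    by (intro bounded_linear_imp_has_derivative bounded_linear_inner_right)
  note inner = this this[THEN frechet_derivative_at']
  show ?thesis
    unfolding Suc k_smooth.simps inner(2) using inner(1)
    by (auto simp: k_smooth_const differentiable_def)
qed (auto intro!: derivative_intros)

lemma k_smooth_add: "k_smooth k f \<Longrightarrow> k_smooth k g \<Longrightarrow> k_smooth k (\<lambda>x. f x + g x)"
proof (induction k arbitrary: f g)
  case (Suc k)
  have "frechet_derivative (\<lambda>x. f x + g x) (at x)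
      = (\<lambda>v. frechet_derivative f (at x) v + frechet_derivative g (at x) v)" for x
    using Suc.prems
    by (intro frechet_derivative_at' has_derivative_add has_derivative_frechet_derivative) simp_all
  then show ?case using Suc by (auto intro!: differentiable_add)
qed (auto intro!: differentiable_add)

lemma k_smooth_mult: "k_smooth k f \<Longrightarrow> k_smooth k g \<Longrightarrow> k_smooth k (\<lambda>x. f x * g x)"
proof (induction k arbitrary: f g)
  case (Suc k)
  have "frechet_derivative (\<lambda>x. f x * g x) (at x)
      = (\<lambda>v. f x * frechet_derivative g (at x) v + frechet_derivative f (at x) v * g x)" for x
    using Suc.prems
    by (intro frechet_derivative_at' has_derivative_mult has_derivative_frechet_derivative) simp_all
  then show ?case using Suc.prems Suc.prems[THEN k_smooth_SucD]
    by (auto intro!: differentiable_mult k_smooth_add Suc.IH)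
qed (auto intro!: differentiable_mult)

lemma frechet_derivative_compose_real:
  fixes g :: "real \<Rightarrow> real"
  assumes "g differentiable (at (f x))" "f differentiable (at x)"
  shows "frechet_derivative (\<lambda>x. g (f x)) (at x) v = deriv g (f x) * frechet_derivative f (at x) v"
proof -
  have "(g has_derivative (*) (deriv g (f x))) (at (f x))"
    using assms(1) by (metis real_differentiable_def DERIV_imp_deriv has_field_derivative_def)
  from has_derivative_compose[OF has_derivative_frechet_derivative[OF assms(2)] this]
  show ?thesis by (simp add: frechet_derivative_at')
qed

lemma k_smooth_Suc_real:
  fixes g :: "real \<Rightarrow> real"
  shows "k_smooth (Suc k) g \<longleftrightarrow> (\<forall>s. g differentiable (at s)) \<and> k_smooth k (deriv g)"
proof -
  have "(\<lambda>s. frechet_derivative g (at s) 1) = deriv g" if "\<And>s. g differentiable (at s)"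
    using frechet_derivative_compose_real[of g "\<lambda>s. s" _ 1] that by auto
  then show ?thesis by auto
qed

lemma k_smooth_compose_real:
  fixes g :: "real \<Rightarrow> real"
  assumes "k_smooth k g" "k_smooth k f"
  shows "k_smooth k (\<lambda>x. g (f x))"
  using assms
proof (induction k arbitrary: g)
  case 0
  then show ?case by (auto intro: differentiable_compose)
next
  case (Suc k)
  have "k_smooth k (\<lambda>x. deriv g (f x))"
    using Suc by (metis k_smooth_SucD k_smooth_Suc_real)
  then show ?case
    using Suc.prems by (auto simp: frechet_derivative_compose_real
        intro: k_smooth_mult differentiable_compose)
qed

lemma k_smooth_local:
  assumes "\<And>x. \<exists>S g. open S \<and> x \<in> S \<and> k_smooth k g \<and> (\<forall>y\<in>S. g y = f y)"
  shows "k_smooth k f"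
  using assms
proof (induction k arbitrary: f)
  have differentiable: "f differentiable (at x)"
    if "\<And>x. \<exists>S g. open S \<and> x \<in> S \<and> k_smooth k g \<and> (\<forall>y\<in>S. g y = f y)" for k f and x :: 'a
    using that[of x] by (metis differentiable_def has_derivative_transform_within_open
        k_smooth_differentiable)
  {
    case 0
    then show ?case using differentiable[of 0 f] by auto
  next
    case (Suc k)
    have "k_smooth k (\<lambda>x. frechet_derivative f (at x) i)" if "i \<in> Basis" for i
    proof (rule Suc.IH)
      fix x
      obtain S g where S: "open S" "x \<in> S" "k_smooth (Suc k) g" "\<forall>y\<in>S. g y = f y"
        using Suc.prems by blast
      then have "frechet_derivative g (at y) = frechet_derivative f (at y)" if "y \<in> S" for y
        using that by (intro frechet_derivative_transform_within_open[of g y S]) auto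
      then show "\<exists>S g. open S \<and> x \<in> S \<and> k_smooth k g \<and> (\<forall>y\<in>S. g y = frechet_derivative f (at y) i)"
        using S that by (intro exI[of _ S] exI[of _ "\<lambda>y. frechet_derivative g (at y) i"]) auto
    qed
    then show ?case using differentiable[OF Suc.prems] by simp
  }
qed

lemma smooth_fun_differentiable: "smooth_fun f \<Longrightarrow> f differentiable (at x)"
  by (auto simp: smooth_fun_iff_k_smooth intro: k_smooth_differentiable)

lemma smooth_fun_partial:
  "smooth_fun f \<Longrightarrow> i \<in> Basis \<Longrightarrow> smooth_fun (\<lambda>x. frechet_derivative f (at x) i)"
  unfolding smooth_fun_iff_k_smooth by (metis k_smooth.simps(2))

lemma smooth_fun_const: "smooth_fun (\<lambda>x. c)"
  by (simp add: smooth_fun_iff_k_smooth k_smooth_const)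

lemma smooth_fun_inner: "smooth_fun (\<lambda>x. a \<bullet> x)"
  by (simp add: smooth_fun_iff_k_smooth k_smooth_inner)

lemma smooth_fun_add: "smooth_fun f \<Longrightarrow> smooth_fun g \<Longrightarrow> smooth_fun (\<lambda>x. f x + g x)"
  by (simp add: smooth_fun_iff_k_smooth k_smooth_add)

lemma smooth_fun_mult: "smooth_fun f \<Longrightarrow> smooth_fun g \<Longrightarrow> smooth_fun (\<lambda>x. f x * g x)"
  by (simp add: smooth_fun_iff_k_smooth k_smooth_mult)

lemma smooth_fun_diff: "smooth_fun f \<Longrightarrow> smooth_fun g \<Longrightarrow> smooth_fun (\<lambda>x. f x - g x)"
  using smooth_fun_add[OF _ smooth_fun_mult[OF smooth_fun_const[of "-1"]], of f g] by simp

lemma smooth_fun_compose_real: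
  fixes g :: "real \<Rightarrow> real"
  shows "smooth_fun g \<Longrightarrow> smooth_fun f \<Longrightarrow> smooth_fun (\<lambda>x. g (f x))"
  by (simp add: smooth_fun_iff_k_smooth k_smooth_compose_real)

lemma smooth_fun_local:
  assumes "\<And>x. \<exists>S g. open S \<and> x \<in> S \<and> smooth_fun g \<and> (\<forall>y\<in>S. g y = f y)"
  shows "smooth_fun f"
  unfolding smooth_fun_iff_k_smooth
proof
  fix k
  show "k_smooth k f"
    by (rule k_smooth_local) (use assms in \<open>meson smooth_fun_iff_k_smooth\<close>)
qed

lemma smooth_fun_continuous_on: "smooth_fun f \<Longrightarrow> continuous_on S f"
  by (meson continuous_at_imp_continuous_on differentiable_imp_continuous_within
      smooth_fun_differentiable)

section \<open>A smooth positive part\<close>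

definition flat_exp :: "real \<Rightarrow> nat \<Rightarrow> real \<Rightarrow> real" where
  "flat_exp \<epsilon> n s = (if s > 0 then inverse s ^ n * exp (- \<epsilon> * inverse s) else 0)"

lemma flat_exp_tendsto_0:
  assumes "\<epsilon> > 0"
  shows "(flat_exp \<epsilon> n \<longlongrightarrow> 0) (at 0)"
proof -
  have "((\<lambda>t. (1/\<epsilon>)^n * ((\<epsilon> * t) ^ n / exp (\<epsilon> * t))) \<longlongrightarrow> (1/\<epsilon>)^n * 0) at_top"
    by (intro tendsto_mult tendsto_const filterlim_compose[OF tendsto_power_div_exp_0]
        filterlim_tendsto_pos_mult_at_top[OF tendsto_const assms] filterlim_ident)
  then have "((\<lambda>t. t ^ n * exp (- \<epsilon> * t)) \<longlongrightarrow> 0) at_top"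
    using assms by (simp add: field_simps exp_minus)
  then have "((\<lambda>s. inverse s ^ n * exp (- \<epsilon> * inverse s)) \<longlongrightarrow> 0) (at_right 0)"
    by (rule filterlim_compose) (rule filterlim_inverse_at_top_right)
  then have "(flat_exp \<epsilon> n \<longlongrightarrow> 0) (at_right 0)"
    by (rule Lim_transform_eventually)
      (use eventually_at_right_less[of 0] in \<open>eventually_elim, simp add: flat_exp_def\<close>)
  moreover have "(flat_exp \<epsilon> n \<longlongrightarrow> 0) (at_left 0)"
    by (rule tendsto_eventually) (auto simp: flat_exp_def eventually_at_filter)
  ultimately show ?thesis by (simp add: filterlim_at_split)
qed

lemma has_real_derivative_inverse_power_times_exp:
  assumes "s \<noteq> 0"
  shows "((\<lambda>s::real. inverse s ^ n * exp (- \<epsilon> * inverse s)) has_real_derivative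
    - real n * (inverse s ^ (n + 1) * exp (- \<epsilon> * inverse s))
      + \<epsilon> * (inverse s ^ (n + 2) * exp (- \<epsilon> * inverse s))) (at s)"
proof -
  have "real n * inverse s ^ (n - 1) * (inverse s)\<^sup>2 = real n * inverse s ^ (n + 1)"
    by (cases n) (simp_all add: power2_eq_square mult.assoc)
  then show ?thesis
    using assms by (auto intro!: derivative_eq_intros simp: algebra_simps power2_eq_square)
qed

lemma has_real_derivative_flat_exp:
  assumes "\<epsilon> > 0"
  shows "(flat_exp \<epsilon> n has_real_derivative
           - real n * flat_exp \<epsilon> (n + 1) s + \<epsilon> * flat_exp \<epsilon> (n + 2) s) (at s)"
proof -
  consider (pos) "s > 0" | (neg) "s < 0" | (zero) "s = 0" by linarith
  then show ?thesis
  proof cases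
    case pos
    show ?thesis
      by (rule has_field_derivative_transform_within_open[where S = "{0<..}"
            and f = "\<lambda>s. inverse s ^ n * exp (- \<epsilon> * inverse s)"])
        (use pos has_real_derivative_inverse_power_times_exp[of s n \<epsilon>]
          in \<open>auto simp: flat_exp_def\<close>)
  next
    case neg
    show ?thesis
      by (rule has_field_derivative_transform_within_open[where S = "{..<0}" and f = "\<lambda>s. 0"])
        (use neg in \<open>auto simp: flat_exp_def\<close>)
  next
    case zero
    have "((\<lambda>h. (flat_exp \<epsilon> n (0 + h) - flat_exp \<epsilon> n 0) / h) \<longlongrightarrow> 0) (at 0)"
      using flat_exp_tendsto_0[OF assms, of "n + 1"]
      by (rule Lim_transform_eventually) (auto simp: flat_exp_def eventually_at_filter field_simps)
    then show ?thesis using zero by (simp add: DERIV_def flat_exp_def)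
  qed
qed

lemma smooth_fun_flat_exp:
  assumes "\<epsilon> > 0"
  shows "smooth_fun (flat_exp \<epsilon> n)"
proof -
  have differentiable: "flat_exp \<epsilon> n differentiable (at s)" for n s
    using has_real_derivative_flat_exp[OF assms] real_differentiable_def by blast
  have "k_smooth k (flat_exp \<epsilon> n)" for k
  proof (induction k arbitrary: n)
    case (Suc k)
    have "deriv (flat_exp \<epsilon> n)
        = (\<lambda>s. - real n * flat_exp \<epsilon> (n + 1) s + \<epsilon> * flat_exp \<epsilon> (n + 2) s)"
      by (intro ext DERIV_imp_deriv has_real_derivative_flat_exp assms)
    then have "k_smooth k (deriv (flat_exp \<epsilon> n))"
      by (simp only:) (intro k_smooth_add k_smooth_mult k_smooth_const Suc.IH)
    then show ?case unfolding k_smooth_Suc_real using differentiable by blast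
  qed (simp add: differentiable)
  then show ?thesis by (simp add: smooth_fun_iff_k_smooth)
qed

definition smooth_pos :: "real \<Rightarrow> real \<Rightarrow> real" where
  "smooth_pos \<epsilon> s = s * flat_exp \<epsilon> 0 s"

lemma smooth_fun_smooth_pos: "\<epsilon> > 0 \<Longrightarrow> smooth_fun (smooth_pos \<epsilon>)"
  unfolding smooth_pos_def[abs_def]
  using smooth_fun_inner[of "1::real"] by (intro smooth_fun_mult smooth_fun_flat_exp) simp_all

lemma deriv_smooth_pos:
  assumes "\<epsilon> > 0"
  shows "deriv (smooth_pos \<epsilon>) s = flat_exp \<epsilon> 0 s + \<epsilon> * flat_exp \<epsilon> 1 s"
proof -
  have "flat_exp \<epsilon> (Suc (Suc 0)) s * s = flat_exp \<epsilon> (Suc 0) s"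
    by (simp add: flat_exp_def)
  then show ?thesis
    unfolding smooth_pos_def[abs_def]
    using has_real_derivative_flat_exp[OF assms, of 0 s]
    by (intro DERIV_imp_deriv) (auto intro!: derivative_eq_intros)
qed

lemma deriv_smooth_pos_nonneg: "\<epsilon> > 0 \<Longrightarrow> 0 \<le> deriv (smooth_pos \<epsilon>) s"
  by (auto simp: deriv_smooth_pos flat_exp_def)

lemma deriv_smooth_pos_le_1:
  assumes "\<epsilon> > 0"
  shows "deriv (smooth_pos \<epsilon>) s \<le> 1"
proof -
  have "(1 + \<epsilon> * inverse s) * exp (- \<epsilon> * inverse s) \<le> 1"
    using exp_ge_add_one_self[of "\<epsilon> * inverse s"] by (simp add: exp_minus field_simps)
  then show ?thesis
    using assms by (auto simp: deriv_smooth_pos flat_exp_def algebra_simps)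
qed

lemma smooth_pos_nonneg: "0 \<le> smooth_pos \<epsilon> s"
  by (auto simp: smooth_pos_def flat_exp_def)

lemma smooth_pos_eq_0: "s \<le> 0 \<Longrightarrow> smooth_pos \<epsilon> s = 0"
  by (auto simp: smooth_pos_def flat_exp_def)

lemma smooth_pos_ge:
  assumes "\<epsilon> > 0"
  shows "s - \<epsilon> \<le> smooth_pos \<epsilon> s"
proof (cases "s > 0")
  case True
  have "s * (1 + - \<epsilon> * inverse s) \<le> s * exp (- \<epsilon> * inverse s)"
    using True by (intro mult_left_mono exp_ge_add_one_self) auto
  then show ?thesis using True by (simp add: smooth_pos_def flat_exp_def algebra_simps)
qed (use assms in \<open>auto simp: smooth_pos_eq_0\<close>)

section \<open>Square-integrable functions\<close>

definition square_integrable :: "'x measure \<Rightarrow> ('x \<Rightarrow> 'b::euclidean_space) \<Rightarrow> bool" where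
  "square_integrable M f \<longleftrightarrow> f \<in> borel_measurable M \<and> integrable M (\<lambda>x. (norm (f x))\<^sup>2)"

definition L2_inner :: "'x measure \<Rightarrow> ('x \<Rightarrow> 'b::euclidean_space) \<Rightarrow> ('x \<Rightarrow> 'b) \<Rightarrow> real" where
  "L2_inner M f g = (LINT x|M. f x \<bullet> g x)"

definition L2_sqnorm :: "'x measure \<Rightarrow> ('x \<Rightarrow> 'b::euclidean_space) \<Rightarrow> real" where
  "L2_sqnorm M f = (LINT x|M. (norm (f x))\<^sup>2)"

lemma square_integrable_measurable [measurable_dest]:
  "square_integrable M f \<Longrightarrow> f \<in> borel_measurable M"
  by (simp add: square_integrable_def)

lemma square_integrable_integrable:
  "square_integrable M f \<Longrightarrow> integrable M (\<lambda>x. (norm (f x))\<^sup>2)"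
  by (simp add: square_integrable_def)

lemma square_integrable_bound:
  assumes "f \<in> borel_measurable M" "integrable M g" "AE x in M. (norm (f x))\<^sup>2 \<le> g x"
  shows "square_integrable M f"
proof -
  have "integrable M (\<lambda>x. (norm (f x))\<^sup>2)"
    using assms(2) by (rule Bochner_Integration.integrable_bound) (use assms in auto)
  then show ?thesis using assms by (simp add: square_integrable_def)
qed

lemma norm_add_sq_le:
  "(norm (a + b))\<^sup>2 \<le> 2 * (norm a)\<^sup>2 + 2 * (norm (b::'b::real_inner))\<^sup>2"
proof -
  have "(norm (a + b))\<^sup>2 + (norm (a - b))\<^sup>2 = 2 * (norm a)\<^sup>2 + 2 * (norm b)\<^sup>2"
    by (simp add: power2_norm_eq_inner inner_simps inner_commute)
  then show ?thesis using zero_le_power2[of "norm (a - b)"] by linarith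
qed

lemma square_integrable_0: "square_integrable M (\<lambda>x. 0)"
  by (simp add: square_integrable_def)

lemma square_integrable_add:
  assumes "square_integrable M f" "square_integrable M g"
  shows "square_integrable M (\<lambda>x. f x + g x)"
proof (rule square_integrable_bound)
  show "integrable M (\<lambda>x. 2 * (norm (f x))\<^sup>2 + 2 * (norm (g x))\<^sup>2)"
    using assms by (simp add: square_integrable_def)
qed (use assms norm_add_sq_le in auto)

lemma square_integrable_scaleR:
  "square_integrable M f \<Longrightarrow> square_integrable M (\<lambda>x. c *\<^sub>R f x)"
  by (auto simp: square_integrable_def power_mult_distrib)

lemma square_integrable_diff:
  "square_integrable M f \<Longrightarrow> square_integrable M g \<Longrightarrow> square_integrable M (\<lambda>x. f x - g x)"
  using square_integrable_add[OF _ square_integrable_scaleR[of M g "-1"], of f] by simp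

lemma square_integrable_norm:
  "square_integrable M f \<Longrightarrow> square_integrable M (\<lambda>x. norm (f x))"
  by (auto simp: square_integrable_def)

lemma integrable_inner_square_integrable:
  assumes "square_integrable M f" "square_integrable M g"
  shows "integrable M (\<lambda>x. f x \<bullet> g x)"
proof -
  have "integrable M (\<lambda>x. ((norm (f x + g x))\<^sup>2 - (norm (f x))\<^sup>2 - (norm (g x))\<^sup>2) / 2)"
    using assms square_integrable_add[OF assms] by (simp add: square_integrable_def)
  then show ?thesis by (simp only: dot_norm)
qed

lemma integrable_scaleR_square_integrable:
  fixes a :: "'x \<Rightarrow> real" and b :: "'x \<Rightarrow> 'b::euclidean_space"
  assumes "square_integrable M a" "square_integrable M b"
  shows "integrable M (\<lambda>x. a x *\<^sub>R b x)"
proof (rule Bochner_Integration.integrable_bound)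
  show "integrable M (\<lambda>x. norm (a x) \<bullet> norm (b x))"
    using assms by (intro integrable_inner_square_integrable square_integrable_norm)
qed (use assms in auto)

lemma L2_inner_commute: "L2_inner M f g = L2_inner M g f"
  by (simp add: L2_inner_def inner_commute)

lemma L2_inner_self: "L2_inner M f f = L2_sqnorm M f"
  by (simp add: L2_inner_def L2_sqnorm_def power2_norm_eq_inner)

lemma L2_inner_add_left:
  assumes "square_integrable M f" "square_integrable M g" "square_integrable M h"
  shows "L2_inner M (\<lambda>x. f x + g x) h = L2_inner M f h + L2_inner M g h"
  using assms by (simp add: L2_inner_def inner_add_left integrable_inner_square_integrable)

lemma L2_inner_scaleR_left: "L2_inner M (\<lambda>x. c *\<^sub>R f x) g = c * L2_inner M f g"
  by (simp add: L2_inner_def)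

lemma L2_inner_diff_left:
  assumes "square_integrable M f" "square_integrable M g" "square_integrable M h"
  shows "L2_inner M (\<lambda>x. f x - g x) h = L2_inner M f h - L2_inner M g h"
  using assms by (simp add: L2_inner_def inner_diff_left integrable_inner_square_integrable)

lemma L2_inner_le:
  assumes "square_integrable M f" "square_integrable M f'" "square_integrable M g"
    and "AE x in M. f x \<bullet> g x \<le> f' x \<bullet> g x"
  shows "L2_inner M f g \<le> L2_inner M f' g"
  unfolding L2_inner_def
  using assms by (intro integral_mono_AE integrable_inner_square_integrable)

lemma L2_inner_mono_left:
  fixes f f' g :: "'x \<Rightarrow> real"
  assumes "square_integrable M f" "square_integrable M f'" "square_integrable M g"
    and "AE x in M. f x \<le> f' x" "\<And>x. 0 \<le> g x"
  shows "L2_inner M f g \<le> L2_inner M f' g"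
proof (rule L2_inner_le[OF assms(1-3)])
  show "AE x in M. f x \<bullet> g x \<le> f' x \<bullet> g x"
    using assms(4) by eventually_elim (simp add: assms(5) mult_right_mono)
qed

lemma L2_sqnorm_nonneg: "0 \<le> L2_sqnorm M f"
  by (simp add: L2_sqnorm_def)

lemma L2_sqnorm_scaleR: "L2_sqnorm M (\<lambda>x. c *\<^sub>R f x) = c\<^sup>2 * L2_sqnorm M f"
  by (simp add: L2_sqnorm_def power_mult_distrib)

lemma L2_sqnorm_mono:
  assumes "square_integrable M f" "square_integrable M g" "AE x in M. norm (f x) \<le> norm (g x)"
  shows "L2_sqnorm M f \<le> L2_sqnorm M g"
  unfolding L2_sqnorm_def
proof (rule integral_mono_AE)
  show "AE x in M. (norm (f x))\<^sup>2 \<le> (norm (g x))\<^sup>2"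
    using assms(3) by eventually_elim (simp add: power_mono)
qed (use assms in \<open>auto intro: square_integrable_integrable\<close>)

lemma L2_sqnorm_add_scaleR:
  assumes "square_integrable M f" "square_integrable M g"
  shows "L2_sqnorm M (\<lambda>x. f x + t *\<^sub>R g x)
    = L2_sqnorm M f + 2 * t * L2_inner M f g + t\<^sup>2 * L2_sqnorm M g"
proof -
  have "(norm (f x + t *\<^sub>R g x))\<^sup>2
      = (norm (f x))\<^sup>2 + 2 * t * (f x \<bullet> g x) + t\<^sup>2 * (norm (g x))\<^sup>2" for x
    unfolding power2_norm_eq_inner
    by (simp add: inner_add_left inner_add_right inner_commute power2_eq_square)
  then show ?thesis
    using assms by (simp add: L2_sqnorm_def L2_inner_def integrable_inner_square_integrable
        square_integrable_integrable)
qed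

lemma L2_sqnorm_add_le:
  assumes "square_integrable M f" "square_integrable M g"
  shows "L2_sqnorm M (\<lambda>x. f x + g x) \<le> 2 * L2_sqnorm M f + 2 * L2_sqnorm M g"
proof -
  have "L2_sqnorm M (\<lambda>x. f x + g x) \<le> (LINT x|M. 2 * (norm (f x))\<^sup>2 + 2 * (norm (g x))\<^sup>2)"
    unfolding L2_sqnorm_def using assms square_integrable_add[OF assms]
    by (intro integral_mono norm_add_sq_le) (auto simp: square_integrable_def)
  then show ?thesis using assms by (simp add: L2_sqnorm_def square_integrable_def)
qed

lemma L2_sqnorm_minus_commute: "L2_sqnorm M (\<lambda>x. f x - g x) = L2_sqnorm M (\<lambda>x. g x - f x)"
  by (simp add: L2_sqnorm_def norm_minus_commute)

lemma L2_sqnorm_eq_0_iff: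
  assumes "square_integrable M f"
  shows "L2_sqnorm M f = 0 \<longleftrightarrow> (AE x in M. f x = 0)"
  unfolding L2_sqnorm_def
  using integral_nonneg_eq_0_iff_AE[OF square_integrable_integrable[OF assms]] by simp

lemma L2_Cauchy_Schwarz:
  assumes f: "square_integrable M f" and g: "square_integrable M g"
  shows "(L2_inner M f g)\<^sup>2 \<le> L2_sqnorm M f * L2_sqnorm M g"
proof (cases "L2_sqnorm M g = 0")
  case True
  then have "AE x in M. f x \<bullet> g x = 0"
    using g by (auto simp: L2_sqnorm_eq_0_iff elim!: eventually_mono)
  then have "L2_inner M f g = 0"
    unfolding L2_inner_def by (rule integral_eq_zero_AE)
  with True show ?thesis by simp
next
  case False
  define t where "t = - L2_inner M f g / L2_sqnorm M g"
  have pos: "0 < L2_sqnorm M g" using False L2_sqnorm_nonneg[of M g] by linarith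
  have "0 \<le> L2_sqnorm M (\<lambda>x. f x + t *\<^sub>R g x)" by (rule L2_sqnorm_nonneg)
  also have "\<dots> = L2_sqnorm M f - (L2_inner M f g)\<^sup>2 / L2_sqnorm M g"
    unfolding L2_sqnorm_add_scaleR[OF f g]
    using pos by (simp add: t_def power2_eq_square field_simps)
  finally show ?thesis using pos by (simp add: field_simps)
qed

lemma L2_sqnorm_le_if_le_L2_inner:
  assumes "square_integrable M f" "square_integrable M g" "L2_sqnorm M g \<le> L2_inner M f g"
  shows "L2_sqnorm M g \<le> L2_sqnorm M f"
proof -
  have "L2_sqnorm M g * L2_sqnorm M g \<le> (L2_inner M f g)\<^sup>2"
    using assms(3) L2_sqnorm_nonneg[of M g] by (simp add: power2_eq_square mult_mono)
  also have "\<dots> \<le> L2_sqnorm M f * L2_sqnorm M g"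
    using assms by (intro L2_Cauchy_Schwarz)
  finally show ?thesis
    using L2_sqnorm_nonneg[of M f] L2_sqnorm_nonneg[of M g]
    by (cases "L2_sqnorm M g = 0") (auto simp: mult_le_cancel_right)
qed

definition L2_tendsto ::
  "'x measure \<Rightarrow> (nat \<Rightarrow> 'x \<Rightarrow> 'b::euclidean_space) \<Rightarrow> ('x \<Rightarrow> 'b) \<Rightarrow> bool" where
  "L2_tendsto M s f \<longleftrightarrow> (\<forall>n. square_integrable M (s n)) \<and> square_integrable M f
     \<and> (\<lambda>n. L2_sqnorm M (\<lambda>x. s n x - f x)) \<longlonglongrightarrow> 0"

lemma L2_tendsto_const: "square_integrable M f \<Longrightarrow> L2_tendsto M (\<lambda>n. f) f"
  by (simp add: L2_tendsto_def L2_sqnorm_def)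

lemma L2_tendsto_dominated_sqnorm:
  assumes "L2_tendsto M s f" "\<And>n. square_integrable M (t n)" "square_integrable M g"
    and "\<And>n. L2_sqnorm M (\<lambda>x. t n x - g x) \<le> C * L2_sqnorm M (\<lambda>x. s n x - f x)"
  shows "L2_tendsto M t g"
proof -
  have "(\<lambda>n. L2_sqnorm M (\<lambda>x. t n x - g x)) \<longlonglongrightarrow> 0"
  proof (rule tendsto_sandwich[OF _ _ tendsto_const])
    show "(\<lambda>n. C * L2_sqnorm M (\<lambda>x. s n x - f x)) \<longlonglongrightarrow> 0"
      using assms(1) by (auto simp: L2_tendsto_def intro: tendsto_mult_right_zero)
  qed (use assms(4) in \<open>auto simp: L2_sqnorm_nonneg\<close>)
  then show ?thesis using assms by (simp add: L2_tendsto_def)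
qed

lemma L2_tendsto_diff:
  assumes s: "L2_tendsto M s f" and t: "L2_tendsto M t g"
  shows "L2_tendsto M (\<lambda>n x. s n x - t n x) (\<lambda>x. f x - g x)"
proof -
  have sq: "square_integrable M (\<lambda>x. s n x - f x)" "square_integrable M (\<lambda>x. g x - t n x)" for n
    using s t by (auto simp: L2_tendsto_def intro: square_integrable_diff)
  have "(\<lambda>n. L2_sqnorm M (\<lambda>x. (s n x - t n x) - (f x - g x))) \<longlonglongrightarrow> 0"
  proof (rule tendsto_sandwich[OF _ _ tendsto_const])
    show "(\<lambda>n. 2 * L2_sqnorm M (\<lambda>x. s n x - f x) + 2 * L2_sqnorm M (\<lambda>x. g x - t n x)) \<longlonglongrightarrow> 0"
      using s t unfolding L2_tendsto_def L2_sqnorm_minus_commute[of M g]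
      by (auto intro!: tendsto_add_zero tendsto_mult_right_zero)
    have "(s n x - t n x) - (f x - g x) = (s n x - f x) + (g x - t n x)" for n x by simp
    then show "\<forall>\<^sub>F n in sequentially. L2_sqnorm M (\<lambda>x. (s n x - t n x) - (f x - g x))
        \<le> 2 * L2_sqnorm M (\<lambda>x. s n x - f x) + 2 * L2_sqnorm M (\<lambda>x. g x - t n x)"
      by (simp only:) (intro always_eventually allI L2_sqnorm_add_le sq)
  qed (simp add: L2_sqnorm_nonneg)
  then show ?thesis
    using s t by (auto simp: L2_tendsto_def intro: square_integrable_diff)
qed

lemma L2_tendsto_inner:
  assumes s: "L2_tendsto M s f" and g: "square_integrable M g"
  shows "(\<lambda>n. L2_inner M (s n) g) \<longlonglongrightarrow> L2_inner M f g"
proof -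
  have sq: "square_integrable M (s n)" "square_integrable M f" for n
    using s by (auto simp: L2_tendsto_def)
  have "(\<lambda>n. (L2_inner M (s n) g - L2_inner M f g)\<^sup>2) \<longlonglongrightarrow> 0"
  proof (rule tendsto_sandwich[OF _ _ tendsto_const])
    show "(\<lambda>n. L2_sqnorm M (\<lambda>x. s n x - f x) * L2_sqnorm M g) \<longlonglongrightarrow> 0"
      using s by (auto simp: L2_tendsto_def intro: tendsto_mult_left_zero)
    show "\<forall>\<^sub>F n in sequentially. (L2_inner M (s n) g - L2_inner M f g)\<^sup>2
        \<le> L2_sqnorm M (\<lambda>x. s n x - f x) * L2_sqnorm M g"
      using L2_Cauchy_Schwarz[OF square_integrable_diff[OF sq] g]
      by (simp add: L2_inner_diff_left sq g)
  qed simp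
  then have "(\<lambda>n. L2_inner M (s n) g - L2_inner M f g) \<longlonglongrightarrow> 0" by simp
  then show ?thesis by (rule LIM_zero_cancel)
qed

lemma L2_tendsto_sqnorm:
  assumes s: "L2_tendsto M s f"
  shows "(\<lambda>n. L2_sqnorm M (s n)) \<longlonglongrightarrow> L2_sqnorm M f"
proof -
  have sq: "square_integrable M (s n)" "square_integrable M f" for n
    using s by (auto simp: L2_tendsto_def)
  have "L2_sqnorm M (s n)
      = L2_sqnorm M (\<lambda>x. s n x - f x) + 2 * L2_inner M (s n) f - L2_sqnorm M f" for n
    using L2_sqnorm_add_scaleR[OF sq, of n "-1"] by simp
  moreover have "(\<lambda>n. L2_sqnorm M (\<lambda>x. s n x - f x) + 2 * L2_inner M (s n) f - L2_sqnorm M f)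
      \<longlonglongrightarrow> 0 + 2 * L2_inner M f f - L2_sqnorm M f"
    using s by (intro tendsto_intros L2_tendsto_inner sq) (simp add: L2_tendsto_def)
  ultimately show ?thesis by (simp add: L2_inner_self)
qed

lemma L2_tendsto_le_AE:
  fixes s t :: "nat \<Rightarrow> 'x \<Rightarrow> real"
  assumes s: "L2_tendsto M s f" and t: "L2_tendsto M t g"
    and le: "\<And>n. AE x in M. s n x \<le> t n x"
  shows "AE x in M. f x \<le> g x"
proof -
  define d where "d n x = (s n x - t n x) - (f x - g x)" for n x
  define w where "w x = max 0 (f x - g x)" for x
  have lim: "L2_tendsto M (\<lambda>n x. s n x - t n x) (\<lambda>x. f x - g x)"
    using s t by (rule L2_tendsto_diff)
  then have d: "square_integrable M (d n)" "(\<lambda>n. L2_sqnorm M (d n)) \<longlonglongrightarrow> 0" for n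
    by (auto simp: L2_tendsto_def d_def[abs_def] intro: square_integrable_diff)
  have fg: "square_integrable M (\<lambda>x. f x - g x)" using lim by (simp add: L2_tendsto_def)
  have w: "square_integrable M w"
  proof (rule square_integrable_bound[OF _ square_integrable_integrable[OF fg]])
    show "AE x in M. (norm (w x))\<^sup>2 \<le> (norm (f x - g x))\<^sup>2"
      by (intro AE_I2 power_mono) (auto simp: w_def)
    show "w \<in> borel_measurable M" unfolding w_def using fg by measurable
  qed
  have "L2_sqnorm M w \<le> L2_sqnorm M (d n)" for n
  proof (rule L2_sqnorm_mono[OF w d(1)])
    show "AE x in M. norm (w x) \<le> norm (d n x)"
      using le[of n] by eventually_elim (auto simp: w_def d_def)
  qed
  then have "L2_sqnorm M w \<le> 0" using d(2) by (intro LIMSEQ_le_const) auto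
  then have "AE x in M. w x = 0"
    using L2_sqnorm_nonneg[of M w] L2_sqnorm_eq_0_iff[OF w] by linarith
  then show ?thesis by eventually_elim (simp add: w_def max_def split: if_splits)
qed

lemma L2_tendsto_unique_AE:
  fixes s :: "nat \<Rightarrow> 'x \<Rightarrow> real"
  assumes "L2_tendsto M s f" "L2_tendsto M s g"
  shows "AE x in M. f x = g x"
proof -
  have "AE x in M. f x \<le> g x" "AE x in M. g x \<le> f x"
    using assms by (auto intro: L2_tendsto_le_AE)
  then show ?thesis by eventually_elim simp
qed

lemma L2_tendsto_cong_AE:
  assumes s: "L2_tendsto M s f" and g: "square_integrable M g" and eq: "AE x in M. f x = g x"
  shows "L2_tendsto M s g"
proof (rule L2_tendsto_dominated_sqnorm[OF s _ g])
  show "square_integrable M (s n)" for n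
    using s by (simp add: L2_tendsto_def)
  show "L2_sqnorm M (\<lambda>x. s n x - g x) \<le> 1 * L2_sqnorm M (\<lambda>x. s n x - f x)" for n
    unfolding mult_1
  proof (rule L2_sqnorm_mono)
    show "AE x in M. norm (s n x - g x) \<le> norm (s n x - f x)"
      using eq by eventually_elim simp
  qed (use s g in \<open>auto simp: L2_tendsto_def intro: square_integrable_diff\<close>)
qed

definition L2_Cauchy :: "'x measure \<Rightarrow> (nat \<Rightarrow> 'x \<Rightarrow> 'b::euclidean_space) \<Rightarrow> bool" where
  "L2_Cauchy M s \<longleftrightarrow> (\<forall>n. square_integrable M (s n))
     \<and> (\<forall>e>0. \<exists>N. \<forall>i\<ge>N. \<forall>j\<ge>N. L2_sqnorm M (\<lambda>x. s i x - s j x) < e)"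

lemma L2_Cauchy_dominated_sqnorm:
  assumes s: "L2_Cauchy M s" and t: "\<And>n. square_integrable M (t n)" and "0 \<le> C"
    and le: "\<And>i j. L2_sqnorm M (\<lambda>x. t i x - t j x) \<le> C * L2_sqnorm M (\<lambda>x. s i x - s j x)"
  shows "L2_Cauchy M t"
  unfolding L2_Cauchy_def
proof (intro conjI allI impI t)
  fix e :: real assume "e > 0"
  then have "0 < e / (C + 1)" using \<open>0 \<le> C\<close> by simp
  then obtain N where "\<forall>i\<ge>N. \<forall>j\<ge>N. L2_sqnorm M (\<lambda>x. s i x - s j x) < e / (C + 1)"
    using s unfolding L2_Cauchy_def by blast
  then have "\<forall>i\<ge>N. \<forall>j\<ge>N. C * L2_sqnorm M (\<lambda>x. s i x - s j x)
      + L2_sqnorm M (\<lambda>x. s i x - s j x) < e"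
    using \<open>0 \<le> C\<close> by (simp add: pos_less_divide_eq algebra_simps)
  then have "\<forall>i\<ge>N. \<forall>j\<ge>N. C * L2_sqnorm M (\<lambda>x. s i x - s j x) < e"
    by (meson L2_sqnorm_nonneg le_add_same_cancel1 order_le_less_trans)
  then show "\<exists>N. \<forall>i\<ge>N. \<forall>j\<ge>N. L2_sqnorm M (\<lambda>x. t i x - t j x) < e"
    by (auto intro: le_less_trans[OF le])
qed

text \<open>Fatou's lemma along an almost everywhere convergent subsequence turns the Cauchy bound
  into a bound on the distance to the pointwise limit.\<close>

lemma L2_diff_limit_of_subseq:
  assumes s: "\<And>n. square_integrable M (s n)" and [measurable]: "f \<in> borel_measurable M"
    and r: "strict_mono r" "AE x in M. (\<lambda>i. s (r i) x) \<longlonglongrightarrow> f x"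
    and N: "\<And>j::nat. j \<ge> N \<Longrightarrow> L2_sqnorm M (\<lambda>x. s n x - s j x) \<le> e" and "0 \<le> e"
  shows "square_integrable M (\<lambda>x. s n x - f x)" "L2_sqnorm M (\<lambda>x. s n x - f x) \<le> e"
proof -
  have [measurable]: "s n \<in> borel_measurable M" for n using s by measurable
  have "(\<integral>\<^sup>+x. ennreal ((norm (s n x - f x))\<^sup>2) \<partial>M)
      = (\<integral>\<^sup>+x. liminf (\<lambda>i. ennreal ((norm (s n x - s (r i) x))\<^sup>2)) \<partial>M)"
  proof (rule nn_integral_cong_AE)
    show "AE x in M. ennreal ((norm (s n x - f x))\<^sup>2)
        = liminf (\<lambda>i. ennreal ((norm (s n x - s (r i) x))\<^sup>2))"
      using r(2)
      by eventually_elim (intro lim_imp_Liminf[symmetric] tendsto_intros, simp_all)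
  qed
  also have "\<dots> \<le> liminf (\<lambda>i. \<integral>\<^sup>+x. ennreal ((norm (s n x - s (r i) x))\<^sup>2) \<partial>M)"
    by (rule nn_integral_liminf) simp
  also have "\<dots> \<le> ennreal e"
  proof (rule Liminf_le)
    show "\<forall>\<^sub>F i in sequentially. (\<integral>\<^sup>+x. ennreal ((norm (s n x - s (r i) x))\<^sup>2) \<partial>M) \<le> ennreal e"
      using eventually_ge_at_top[of N]
    proof eventually_elim
      case (elim i)
      then have "L2_sqnorm M (\<lambda>x. s n x - s (r i) x) \<le> e"
        using N seq_suble[OF r(1), of i] by (meson order_trans)
      then show ?case
        using square_integrable_diff[OF s[of n] s[of "r i"]]
        by (subst nn_integral_eq_integral)
          (auto simp: square_integrable_def L2_sqnorm_def intro: ennreal_leI)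
    qed
  qed simp
  finally have le: "(\<integral>\<^sup>+x. ennreal ((norm (s n x - f x))\<^sup>2) \<partial>M) \<le> ennreal e" .
  then have int: "integrable M (\<lambda>x. (norm (s n x - f x))\<^sup>2)"
    by (intro integrableI_bounded) (auto simp: order.strict_trans1)
  then show "square_integrable M (\<lambda>x. s n x - f x)" by (simp add: square_integrable_def)
  show "L2_sqnorm M (\<lambda>x. s n x - f x) \<le> e"
    using le \<open>0 \<le> e\<close> nn_integral_eq_integral[OF int] by (simp add: L2_sqnorm_def)
qed

context finite_measure
begin

lemma square_integrable_bounded:
  assumes "f \<in> borel_measurable M" "AE x in M. norm (f x) \<le> B"
  shows "square_integrable M f"
proof (rule square_integrable_bound)
  show "AE x in M. (norm (f x))\<^sup>2 \<le> B\<^sup>2"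
    using assms(2) by eventually_elim (auto intro: power_mono)
qed (use assms in auto)

lemma integrable_square_integrable:
  assumes "square_integrable M f"
  shows "integrable M f"
proof -
  have "integrable M (\<lambda>x. norm (f x))"
    by (rule square_integrable_imp_integrable) (use assms in \<open>auto simp: square_integrable_def\<close>)
  then show ?thesis using assms by (simp add: integrable_norm_iff square_integrable_def)
qed

lemma integral_norm_sq_le:
  assumes "square_integrable M f"
  shows "(LINT x|M. norm (f x))\<^sup>2 \<le> L2_sqnorm M f * measure M (space M)"
proof -
  have "square_integrable M (\<lambda>x. 1::real)" by (simp add: square_integrable_def)
  from L2_Cauchy_Schwarz[OF square_integrable_norm[OF assms] this]
  show ?thesis by (simp add: L2_inner_def L2_sqnorm_def)
qed

lemma L2_tendsto_dominated:
  fixes s :: "nat \<Rightarrow> 'a \<Rightarrow> real"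
  assumes s [measurable]: "\<And>n. s n \<in> borel_measurable M"
    and l [measurable]: "l \<in> borel_measurable M"
    and s_le: "\<And>n. AE x in M. norm (s n x) \<le> B" and lim: "AE x in M. (\<lambda>n. s n x) \<longlonglongrightarrow> l x"
  shows "L2_tendsto M s l"
proof -
  have "AE x in M. \<forall>n. norm (s n x) \<le> B" using s_le by (simp add: AE_all_countable)
  with lim have l_le: "AE x in M. norm (l x) \<le> B"
    by eventually_elim (rule LIMSEQ_le_const2[OF tendsto_norm], auto)
  have "(\<lambda>n. LINT x|M. (norm (s n x - l x))\<^sup>2) \<longlonglongrightarrow> (LINT x|M. 0)"
  proof (rule integral_dominated_convergence)
    show "AE x in M. (\<lambda>n. (norm (s n x - l x))\<^sup>2) \<longlonglongrightarrow> 0"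
      using lim
      by eventually_elim (intro tendsto_null_power tendsto_norm_zero LIM_zero, simp_all)
    show "AE x in M. norm ((norm (s n x - l x))\<^sup>2) \<le> (2 * B)\<^sup>2" for n
      using s_le[of n] l_le
    proof eventually_elim
      case (elim x)
      have "norm (s n x - l x) \<le> 2 * B" using norm_triangle_ineq4[of "s n x" "l x"] elim by linarith
      then show ?case using power_mono[of "norm (s n x - l x)" "2 * B" 2] by simp
    qed
  qed auto
  then show ?thesis
    using square_integrable_bounded[OF s s_le] square_integrable_bounded[OF l l_le]
    by (simp add: L2_tendsto_def L2_sqnorm_def)
qed

lemma L2_Cauchy_imp_L1_Cauchy:
  assumes "L2_Cauchy M s" "e > 0"
  shows "\<exists>N. \<forall>i\<ge>N. \<forall>j\<ge>N. (LINT x|M. norm (s i x - s j x)) < e"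
proof -
  define m where "m = measure M (space M) + 1"
  have m: "0 < m" "measure M (space M) \<le> m" by (simp_all add: m_def add_nonneg_pos)
  then have "0 < e\<^sup>2 / m" using \<open>e > 0\<close> by simp
  then obtain N where N: "\<forall>i\<ge>N. \<forall>j\<ge>N. L2_sqnorm M (\<lambda>x. s i x - s j x) < e\<^sup>2 / m"
    using assms(1) unfolding L2_Cauchy_def by blast
  have "(LINT x|M. norm (s i x - s j x)) < e" if "i \<ge> N" "j \<ge> N" for i j
  proof (rule power_less_imp_less_base)
    have "(LINT x|M. norm (s i x - s j x))\<^sup>2
        \<le> L2_sqnorm M (\<lambda>x. s i x - s j x) * measure M (space M)"
      using assms by (intro integral_norm_sq_le square_integrable_diff) (auto simp: L2_Cauchy_def)
    also have "\<dots> \<le> L2_sqnorm M (\<lambda>x. s i x - s j x) * m"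
      by (intro mult_left_mono m L2_sqnorm_nonneg)
    also have "\<dots> < e\<^sup>2" using N that m by (simp add: field_simps)
    finally show "(LINT x|M. norm (s i x - s j x))\<^sup>2 < e\<^sup>2" .
  qed (use \<open>e > 0\<close> in simp)
  then show ?thesis by blast
qed

lemma L2_Cauchy_convergent:
  assumes cauchy: "L2_Cauchy M s"
  obtains f where "L2_tendsto M s f"
proof -
  have s: "square_integrable M (s n)" for n using cauchy by (simp add: L2_Cauchy_def)
  then have [measurable]: "s n \<in> borel_measurable M" for n by measurable
  obtain r where r: "strict_mono r" and ae: "AE x in M. Cauchy (\<lambda>i. s (r i) x)"
    using cauchy_L1_AE_cauchy_subseq[of M s] integrable_square_integrable[OF s]
      L2_Cauchy_imp_L1_Cauchy[OF cauchy] by blast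
  define f where "f x = lim (\<lambda>i. s (r i) x)" for x
  have [measurable]: "f \<in> borel_measurable M"
    unfolding f_def by (intro borel_measurable_lim_metric) simp
  have lim: "AE x in M. (\<lambda>i. s (r i) x) \<longlonglongrightarrow> f x"
    using ae by eventually_elim (simp add: f_def Cauchy_convergent_iff convergent_LIMSEQ_iff)
  have eventually_close: "\<exists>N. \<forall>n\<ge>N. square_integrable M (\<lambda>x. s n x - f x)
      \<and> L2_sqnorm M (\<lambda>x. s n x - f x) \<le> e" if "e > 0" for e
  proof -
    obtain N where "\<forall>i\<ge>N. \<forall>j\<ge>N. L2_sqnorm M (\<lambda>x. s i x - s j x) < e"
      using cauchy \<open>e > 0\<close> by (auto simp: L2_Cauchy_def)
    then have "\<forall>n\<ge>N. square_integrable M (\<lambda>x. s n x - f x) \<and> L2_sqnorm M (\<lambda>x. s n x - f x) \<le> e"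
      using L2_diff_limit_of_subseq[OF s _ r lim, of N _ e] \<open>e > 0\<close> by (auto simp: less_imp_le)
    then show ?thesis ..
  qed
  obtain N where "square_integrable M (\<lambda>x. s N x - f x)" using eventually_close[of 1] by auto
  from square_integrable_diff[OF s[of N] this] have "square_integrable M f" by simp
  moreover have "(\<lambda>n. L2_sqnorm M (\<lambda>x. s n x - f x)) \<longlonglongrightarrow> 0"
  proof (rule LIMSEQ_I)
    fix e :: real assume "e > 0"
    then obtain N where "\<forall>n\<ge>N. L2_sqnorm M (\<lambda>x. s n x - f x) \<le> e / 2"
      using eventually_close[of "e / 2"] by auto
    then show "\<exists>N. \<forall>n\<ge>N. norm (L2_sqnorm M (\<lambda>x. s n x - f x) - 0) < e"
      using \<open>e > 0\<close> by (intro exI[of _ N]) (force simp: L2_sqnorm_nonneg)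
  qed
  ultimately show ?thesis using s by (intro that[of f]) (simp add: L2_tendsto_def)
qed

end

section \<open>Gradients and test functions\<close>

lemma grad_inner_Basis: "i \<in> Basis \<Longrightarrow> grad f x \<bullet> i = frechet_derivative f (at x) i"
  by (simp add: grad_def inner_sum_left_Basis)

lemma has_derivative_grad:
  assumes "f differentiable (at x)"
  shows "(f has_derivative (\<lambda>v. grad f x \<bullet> v)) (at x)"
proof -
  have lin: "linear (frechet_derivative f (at x))"
    using assms by (rule linear_frechet_derivative)
  have "frechet_derivative f (at x) v = grad f x \<bullet> v" for v
  proof -
    have "frechet_derivative f (at x) v = frechet_derivative f (at x) (\<Sum>i\<in>Basis. (v \<bullet> i) *\<^sub>R i)"
      by (simp add: euclidean_representation)
    also have "\<dots> = (\<Sum>i\<in>Basis. (v \<bullet> i) * frechet_derivative f (at x) i)"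
      by (simp add: linear_sum[OF lin] linear_cmul[OF lin])
    also have "\<dots> = grad f x \<bullet> v"
      unfolding grad_def inner_sum_left
      by (intro sum.cong refl) (simp add: inner_commute mult.commute)
    finally show ?thesis .
  qed
  then have "frechet_derivative f (at x) = (\<lambda>v. grad f x \<bullet> v)" by (rule ext)
  then show ?thesis using has_derivative_frechet_derivative[OF assms] by simp
qed

lemma grad_eqI:
  assumes "(f has_derivative (\<lambda>v. g \<bullet> v)) (at x)"
  shows "grad f x = g"
  by (rule euclidean_eqI) (simp add: grad_inner_Basis frechet_derivative_at'[OF assms])

lemma grad_const: "grad (\<lambda>x. c) x = 0"
  by (rule grad_eqI) simp

lemma grad_add:
  assumes "f differentiable (at x)" "g differentiable (at x)"
  shows "grad (\<lambda>x. f x + g x) x = grad f x + grad g x"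
  using assms by (auto intro!: grad_eqI derivative_eq_intros has_derivative_grad
      simp: inner_add_left)

lemma grad_diff:
  assumes "f differentiable (at x)" "g differentiable (at x)"
  shows "grad (\<lambda>x. f x - g x) x = grad f x - grad g x"
  using assms by (auto intro!: grad_eqI derivative_eq_intros has_derivative_grad
      simp: inner_diff_left)

lemma grad_mult:
  assumes "f differentiable (at x)" "g differentiable (at x)"
  shows "grad (\<lambda>x. f x * g x) x = f x *\<^sub>R grad g x + g x *\<^sub>R grad f x"
  using assms by (auto intro!: grad_eqI derivative_eq_intros has_derivative_grad
      simp: inner_add_left)

lemma grad_cmult: "f differentiable (at x) \<Longrightarrow> grad (\<lambda>x. c * f x) x = c *\<^sub>R grad f x"
  by (simp add: grad_mult grad_const)

lemma grad_inner: "grad (\<lambda>x. a \<bullet> x) x = a"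
  by (auto intro!: grad_eqI derivative_eq_intros)

lemma grad_compose_real:
  assumes "g differentiable (at (f x))" "f differentiable (at x)"
  shows "grad (\<lambda>x. g (f x)) x = deriv g (f x) *\<^sub>R grad f x"
  by (rule euclidean_eqI) (simp add: grad_inner_Basis frechet_derivative_compose_real[OF assms])

lemma grad_cong_open:
  assumes "open S" "x \<in> S" "\<And>y. y \<in> S \<Longrightarrow> f y = g y" "f differentiable (at x)"
  shows "grad g x = grad f x"
  using frechet_derivative_transform_within_open[OF assms(4,1,2,3)] by (simp add: grad_def)

lemma has_derivative_0_outside:
  assumes "closed S" "\<And>x. x \<notin> S \<Longrightarrow> f x = 0" "x \<notin> S"
  shows "(f has_derivative (\<lambda>v. 0)) (at x)"
  by (rule has_derivative_transform_within_open[OF has_derivative_const[of 0], of "- S"])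
    (use assms in auto)

lemma continuous_on_grad:
  assumes "smooth_fun f"
  shows "continuous_on S (grad f)"
  unfolding grad_def[abs_def]
  using assms by (intro continuous_intros smooth_fun_continuous_on smooth_fun_partial)

lemma test_funI:
  assumes "smooth_fun \<phi>" "compact S" "S \<subseteq> \<Omega>" "\<And>x. x \<notin> S \<Longrightarrow> \<phi> x = 0"
  shows "test_fun \<Omega> \<phi>"
proof -
  have sub: "closure {x. \<phi> x \<noteq> 0} \<subseteq> S"
    using assms by (intro closure_minimal compact_imp_closed) auto
  then have "compact (closure {x. \<phi> x \<noteq> 0})"
    using compact_Int_closed[OF assms(2), of "closure {x. \<phi> x \<noteq> 0}"]
    by (simp add: Int_absorb1)
  then show ?thesis using sub assms by (auto simp: test_fun_def)
qed

lemma test_funE: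
  assumes "test_fun \<Omega> \<phi>"
  obtains S where "compact S" "S \<subseteq> \<Omega>" "\<And>x. x \<notin> S \<Longrightarrow> \<phi> x = 0"
  using assms closure_subset[of "{x. \<phi> x \<noteq> 0}"]
  by (intro that[of "closure {x. \<phi> x \<noteq> 0}"]) (auto simp: test_fun_def)

lemma test_fun_smooth: "test_fun \<Omega> \<phi> \<Longrightarrow> smooth_fun \<phi>"
  by (simp add: test_fun_def)

lemma test_fun_differentiable: "test_fun \<Omega> \<phi> \<Longrightarrow> \<phi> differentiable (at x)"
  by (rule smooth_fun_differentiable[OF test_fun_smooth])

lemma test_fun_mult_smooth:
  assumes "test_fun \<Omega> \<phi>" "smooth_fun f"
  shows "test_fun \<Omega> (\<lambda>x. \<phi> x * f x)"
proof -
  obtain S where "compact S" "S \<subseteq> \<Omega>" "\<And>x. x \<notin> S \<Longrightarrow> \<phi> x = 0"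
    using assms(1) by (metis test_funE)
  then show ?thesis
    using assms by (intro test_funI[of _ S] smooth_fun_mult) (auto simp: test_fun_smooth)
qed

lemma test_fun_cmult: "test_fun \<Omega> \<phi> \<Longrightarrow> test_fun \<Omega> (\<lambda>x. c * \<phi> x)"
  using test_fun_mult_smooth[OF _ smooth_fun_const[of c]] by (simp add: mult.commute)

lemma test_fun_add:
  assumes "test_fun \<Omega> \<phi>" "test_fun \<Omega> \<psi>"
  shows "test_fun \<Omega> (\<lambda>x. \<phi> x + \<psi> x)"
proof -
  obtain S T where "compact S" "S \<subseteq> \<Omega>" "\<And>x. x \<notin> S \<Longrightarrow> \<phi> x = 0"
    "compact T" "T \<subseteq> \<Omega>" "\<And>x. x \<notin> T \<Longrightarrow> \<psi> x = 0"
    using assms by (metis test_funE)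
  then show ?thesis
    using assms by (intro test_funI[of _ "S \<union> T"] smooth_fun_add) (auto simp: test_fun_smooth)
qed

lemma test_fun_diff:
  "test_fun \<Omega> \<phi> \<Longrightarrow> test_fun \<Omega> \<psi> \<Longrightarrow> test_fun \<Omega> (\<lambda>x. \<phi> x - \<psi> x)"
  using test_fun_add[OF _ test_fun_cmult[of \<Omega> \<psi> "-1"]] by simp

lemma test_fun_0: "test_fun \<Omega> (\<lambda>x. 0)"
  by (rule test_funI[of _ "{}"]) (auto simp: smooth_fun_const)

section \<open>Integrals of directional derivatives\<close>

lemma has_real_derivative_along_line:
  fixes \<phi> :: "'a::real_normed_vector \<Rightarrow> real"
  assumes "(\<phi> has_derivative \<phi>') (at (x + s *\<^sub>R a))"
  shows "((\<lambda>s. \<phi> (x + s *\<^sub>R a)) has_real_derivative \<phi>' a) (at s)"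
proof -
  have "((\<lambda>s. x + s *\<^sub>R a) has_derivative (\<lambda>h. h *\<^sub>R a)) (at s)"
    by (auto intro!: derivative_eq_intros)
  from has_derivative_compose[OF this assms] show ?thesis
    using linear_cmul[OF has_derivative_linear[OF assms]]
    by (simp add: has_field_derivative_def mult.commute[of _ "\<phi>' a"])
qed

lemma difference_quotient_bound:
  fixes \<phi> :: "'a::real_normed_vector \<Rightarrow> real"
  assumes deriv: "\<And>x. (\<phi> has_derivative \<phi>' x) (at x)" and bound: "\<And>x. \<bar>\<phi>' x a\<bar> \<le> B"
  shows "\<bar>(\<phi> (x + t *\<^sub>R a) - \<phi> x) / t\<bar> \<le> B"
proof (cases "t = 0")
  case True
  then show ?thesis using bound[of x] by simp
next
  case False
  have "\<bar>\<phi> (x + t *\<^sub>R a) - \<phi> (x + 0 *\<^sub>R a)\<bar> \<le> B * \<bar>t - 0\<bar>"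
    using field_differentiable_bound[of UNIV "\<lambda>s. \<phi> (x + s *\<^sub>R a)" "\<lambda>s. \<phi>' (x + s *\<^sub>R a) a" B t 0]
      has_real_derivative_along_line[OF deriv] bound by simp
  then show ?thesis using False by (simp add: abs_divide divide_le_eq)
qed

lemma integrable_lborel_compact_support:
  fixes f :: "'a::euclidean_space \<Rightarrow> real"
  assumes "continuous_on UNIV f" "compact S" "\<And>x. x \<notin> S \<Longrightarrow> f x = 0"
  shows "integrable lborel f"
proof -
  have "integrable lborel (\<lambda>x. indicator S x *\<^sub>R f x)"
    using assms by (intro borel_integrable_compact) (auto intro: continuous_on_subset)
  moreover have "(\<lambda>x. indicator S x *\<^sub>R f x) = f"
    using assms(3) by (auto simp: indicator_def fun_eq_iff)
  ultimately show ?thesis by simp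
qed

lemma integral_lborel_translation:
  fixes f :: "'a::euclidean_space \<Rightarrow> real"
  assumes "integrable lborel f"
  shows "integrable lborel (\<lambda>x. f (x + c))" "(LINT x|lborel. f (x + c)) = (LINT x|lborel. f x)"
  using assms integrable_distr_eq[of "(+) c" lborel borel f]
    integral_distr[of "(+) c" lborel borel f]
    borel_measurable_integrable[OF assms]
  by (simp_all add: lborel_distr_plus add.commute)

lemma difference_quotient_le_indicator:
  fixes \<phi> :: "'a::euclidean_space \<Rightarrow> real"
  assumes deriv: "\<And>x. (\<phi> has_derivative \<phi>' x) (at x)" and bound: "\<And>x. \<bar>\<phi>' x a\<bar> \<le> B"
    and supp: "\<And>x. \<phi> x \<noteq> 0 \<Longrightarrow> norm x \<le> R" and t: "0 \<le> t" "t \<le> 1"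
  shows "norm ((\<phi> (x + t *\<^sub>R a) - \<phi> x) / t) \<le> indicator (cball 0 (R + norm a)) x *\<^sub>R B"
proof (cases "norm x \<le> R + norm a")
  case True
  then show ?thesis using difference_quotient_bound[OF deriv bound] by simp
next
  case False
  have "norm x \<le> norm (x + t *\<^sub>R a) + norm (t *\<^sub>R a)"
    using norm_triangle_ineq4[of "x + t *\<^sub>R a" "t *\<^sub>R a"] by simp
  moreover have "norm (t *\<^sub>R a) \<le> norm a"
    using t by (simp add: mult_left_le_one_le)
  ultimately have "\<phi> (x + t *\<^sub>R a) = 0" "\<phi> x = 0"
    using supp[of x] supp[of "x + t *\<^sub>R a"] False norm_ge_zero[of a] by force+
  then show ?thesis using False by (simp add: indicator_def)
qed

lemma difference_quotient_LIMSEQ: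
  fixes \<phi> :: "'a::real_normed_vector \<Rightarrow> real"
  assumes "(\<phi> has_derivative \<phi>') (at x)" "t \<longlonglongrightarrow> 0" "\<And>n::nat. t n \<noteq> 0"
  shows "(\<lambda>n. (\<phi> (x + t n *\<^sub>R a) - \<phi> x) / t n) \<longlonglongrightarrow> \<phi>' a"
proof -
  have "((\<lambda>h. (\<phi> (x + h *\<^sub>R a) - \<phi> x) / h) \<longlongrightarrow> \<phi>' a) (at 0)"
    using has_real_derivative_along_line[of \<phi> \<phi>' x 0 a] assms(1) by (simp add: DERIV_def)
  moreover have "filterlim t (at 0) sequentially"
    using assms(2,3) by (simp add: filterlim_at)
  ultimately show ?thesis by (rule filterlim_compose)
qed

lemma directional_derivative_bounded:
  fixes \<phi> :: "'a::euclidean_space \<Rightarrow> real"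
  assumes deriv: "\<And>x. (\<phi> has_derivative \<phi>' x) (at x)" and cont: "continuous_on UNIV (\<lambda>x. \<phi>' x a)"
    and S: "compact S" "\<And>x. x \<notin> S \<Longrightarrow> \<phi> x = 0"
  obtains B where "\<And>x. \<bar>\<phi>' x a\<bar> \<le> B"
proof -
  obtain B where "\<And>x. x \<in> S \<Longrightarrow> \<bar>\<phi>' x a\<bar> \<le> B" and "0 \<le> B"
    using continuous_on_compact_bound[OF S(1) continuous_on_subset[OF cont subset_UNIV]]
    by (metis real_norm_def)
  moreover have "\<phi>' x a = 0" if "x \<notin> S" for x
    using has_derivative_unique[OF deriv
        has_derivative_0_outside[OF compact_imp_closed[OF S(1)] S(2) that]] by simp
  ultimately have "\<bar>\<phi>' x a\<bar> \<le> B" for x by (cases "x \<in> S") auto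
  then show ?thesis by (rule that)
qed

text \<open>Translation invariance makes every difference quotient integrate to zero.\<close>

lemma integral_directional_derivative_eq_0:
  fixes \<phi> :: "'a::euclidean_space \<Rightarrow> real"
  assumes deriv: "\<And>x. (\<phi> has_derivative \<phi>' x) (at x)" and cont: "continuous_on UNIV (\<lambda>x. \<phi>' x a)"
    and S: "compact S" "\<And>x. x \<notin> S \<Longrightarrow> \<phi> x = 0"
  shows "(LINT x|lborel. \<phi>' x a) = 0"
proof -
  obtain B where B: "\<And>x. \<bar>\<phi>' x a\<bar> \<le> B"
    using directional_derivative_bounded[OF deriv cont S] by blast
  obtain R where "\<And>x. x \<in> S \<Longrightarrow> norm x \<le> R"
    using compact_imp_bounded[OF S(1)] by (auto simp: bounded_iff)
  then have R: "norm x \<le> R" if "\<phi> x \<noteq> 0" for x using S(2) that by blast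
  define t where "t n = inverse (real (Suc n))" for n
  have t: "0 < t n" "t n \<le> 1" for n by (auto simp: t_def field_simps)
  define q where "q n x = (\<phi> (x + t n *\<^sub>R a) - \<phi> x) / t n" for n x
  have cont_\<phi>: "continuous_on UNIV \<phi>"
    using deriv by (meson continuous_at_imp_continuous_on has_derivative_continuous)
  have int: "integrable lborel \<phi>"
    using cont_\<phi> S(1,2) by (rule integrable_lborel_compact_support)
  have "(\<lambda>n. LINT x|lborel. q n x) \<longlonglongrightarrow> (LINT x|lborel. \<phi>' x a)"
  proof (rule integral_dominated_convergence)
    show "integrable lborel (\<lambda>x. indicator (cball 0 (R + norm a)) x *\<^sub>R B)"
      by (intro borel_integrable_compact) auto
    show "(\<lambda>x. \<phi>' x a) \<in> borel_measurable lborel"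
      using borel_measurable_continuous_onI[OF cont] by simp
    show "q n \<in> borel_measurable lborel" for n
      unfolding q_def using borel_measurable_continuous_onI[OF cont_\<phi>] by simp
    show "AE x in lborel. (\<lambda>n. q n x) \<longlonglongrightarrow> \<phi>' x a"
      unfolding q_def using LIMSEQ_inverse_real_of_nat
      by (intro AE_I2 difference_quotient_LIMSEQ deriv) (simp_all add: t_def[abs_def])
    show "AE x in lborel. norm (q n x) \<le> indicator (cball 0 (R + norm a)) x *\<^sub>R B" for n
      unfolding q_def using deriv B R t[of n]
      by (intro AE_I2 difference_quotient_le_indicator) auto
  qed
  then show ?thesis
    using integral_lborel_translation[OF int] int by (simp add: q_def LIMSEQ_const_iff)
qed

section \<open>Slabs\<close>

lemma cInf_sequence:
  fixes X :: "real set"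
  assumes "X \<noteq> {}" "bdd_below X"
  obtains y where "\<And>n::nat. y n \<in> X" "y \<longlonglongrightarrow> Inf X"
proof -
  obtain y where "\<forall>n. y n \<in> X" "y \<longlonglongrightarrow> Inf X"
    using closure_contains_Inf[OF assms] unfolding closure_sequential by blast
  then show ?thesis by (intro that[of y]) simp_all
qed

definition slab :: "'a::euclidean_space \<Rightarrow> real \<Rightarrow> real \<Rightarrow> 'a set" where
  "slab a b1 b2 = {x. b1 \<le> a \<bullet> x \<and> a \<bullet> x \<le> b2}"

lemma slab_width_nonneg: "S \<noteq> {} \<Longrightarrow> S \<subseteq> slab a b1 b2 \<Longrightarrow> b1 \<le> b2"
  unfolding slab_def by fastforce

lemma bounded_subset_slab:
  fixes S :: "'a::euclidean_space set"
  assumes "bounded S"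
  obtains a b1 b2 where "norm a = 1" "S \<subseteq> slab a b1 b2"
proof -
  obtain R where R: "\<And>x. x \<in> S \<Longrightarrow> norm x \<le> R"
    using assms by (auto simp: bounded_iff)
  obtain a :: 'a where a: "norm a = 1" using vector_choose_size[of 1] by auto
  have "\<bar>a \<bullet> x\<bar> \<le> R" if "x \<in> S" for x
    using Cauchy_Schwarz_ineq2[of a x] a R[OF that] by simp
  then have "S \<subseteq> slab a (- R) R" by (auto simp: slab_def abs_le_iff minus_le_iff)
  with a show ?thesis by (rule that)
qed

lemma slab_diam_sequence:
  assumes "bounded S" "S \<noteq> {}"
  obtains a b1 b2 where "\<And>n::nat. norm (a n) = 1" "\<And>n. S \<subseteq> slab (a n) (b1 n) (b2 n)"
    "(\<lambda>n. b2 n - b1 n) \<longlonglongrightarrow> slab_diam S"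
proof -
  define widths where "widths = {b2 - b1 | a b1 b2. norm a = 1 \<and> S \<subseteq> slab a b1 b2}"
  obtain a b1 b2 where "norm a = 1" "S \<subseteq> slab a b1 b2"
    using bounded_subset_slab[OF assms(1)] .
  then have "widths \<noteq> {}" unfolding widths_def by blast
  moreover have "bdd_below widths"
    using slab_width_nonneg[OF assms(2)] by (intro bdd_belowI[of _ 0]) (auto simp: widths_def)
  moreover have "slab_diam S = Inf widths"
    by (simp add: slab_diam_def widths_def slab_def)
  ultimately obtain y where y: "\<And>n. y n \<in> widths" "y \<longlonglongrightarrow> slab_diam S"
    using cInf_sequence[of widths] by (simp only:) blast
  have "\<forall>n. \<exists>a b1 b2. norm a = 1 \<and> S \<subseteq> slab a b1 b2 \<and> y n = b2 - b1"
    using y(1) unfolding widths_def by blast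
  then obtain a b1 b2 where "\<And>n. norm (a n) = 1" "\<And>n. S \<subseteq> slab (a n) (b1 n) (b2 n)"
    and width: "\<And>n. y n = b2 n - b1 n" by metis
  then show ?thesis using y(2) by (intro that[of a b1 b2]) (simp_all flip: width)
qed

section \<open>Functions vanishing on the boundary\<close>

locale bounded_open_set =
  fixes \<Omega> :: "'a::euclidean_space set"
  assumes open_\<Omega>: "open \<Omega>" and bounded_\<Omega>: "bounded \<Omega>" and nonempty_\<Omega>: "\<Omega> \<noteq> {}"
begin

abbreviation "\<mu> \<equiv> lebesgue_on \<Omega>"

lemma lmeasurable_\<Omega>: "\<Omega> \<in> lmeasurable"
  using open_\<Omega> bounded_\<Omega> by (intro lmeasurable_open)

lemma sets_\<Omega> [measurable]: "\<Omega> \<in> sets lebesgue"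
  using lmeasurable_\<Omega> by (rule fmeasurableD)

sublocale finite_measure \<mu>
  using lmeasurable_\<Omega> by (rule finite_measure_lebesgue_on)

lemma AE_\<mu>_iff: "(AE x in \<mu>. P x) \<longleftrightarrow> (AE x in lebesgue. x \<in> \<Omega> \<longrightarrow> P x)"
  by (rule AE_restrict_space_iff) simp

lemma set_integrable_iff_integrable_\<mu>:
  fixes f :: "'a \<Rightarrow> 'b::{banach, second_countable_topology}"
  shows "set_integrable lebesgue \<Omega> f \<longleftrightarrow> integrable \<mu> f"
  by (simp add: set_integrable_def integrable_restrict_space)

lemma set_integral_eq_integral_\<mu>:
  fixes f :: "'a \<Rightarrow> 'b::{banach, second_countable_topology}"
  shows "(LINT x:\<Omega>|lebesgue. f x) = (LINT x|\<mu>. f x)"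
  by (simp add: set_lebesgue_integral_def integral_restrict_space)

lemma L2_on_iff_square_integrable: "L2_on \<Omega> f \<longleftrightarrow> square_integrable \<mu> f"
  by (simp add: L2_on_def square_integrable_def set_integrable_iff_integrable_\<mu>)

lemma square_integrable_continuous:
  assumes "continuous_on UNIV f"
  shows "square_integrable \<mu> f"
proof -
  obtain B where B: "\<And>x. x \<in> closure \<Omega> \<Longrightarrow> norm (f x) \<le> B"
    using continuous_on_compact_bound[of "closure \<Omega>" f] bounded_\<Omega> assms
    by (metis compact_closure continuous_on_subset subset_UNIV)
  show ?thesis
  proof (rule square_integrable_bounded)
    have "f \<in> borel_measurable lebesgue"
      using borel_measurable_continuous_onI[OF assms] by (intro measurable_completion) simp
    then show "f \<in> borel_measurable \<mu>" by (rule measurable_restrict_space1)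
    show "AE x in \<mu>. norm (f x) \<le> B"
      using B closure_subset by (intro AE_I2) auto
  qed
qed

lemma square_integrable_smooth: "smooth_fun f \<Longrightarrow> square_integrable \<mu> f"
  by (simp add: square_integrable_continuous smooth_fun_continuous_on)

lemma square_integrable_grad: "smooth_fun f \<Longrightarrow> square_integrable \<mu> (grad f)"
  by (simp add: square_integrable_continuous continuous_on_grad)

lemma square_integrable_partial: "smooth_fun f \<Longrightarrow> square_integrable \<mu> (\<lambda>x. grad f x \<bullet> a)"
  by (intro square_integrable_continuous continuous_intros continuous_on_grad)

lemma square_integrable_test: "test_fun \<Omega> \<phi> \<Longrightarrow> square_integrable \<mu> \<phi>"
  by (rule square_integrable_smooth[OF test_fun_smooth])

lemma square_integrable_grad_test: "test_fun \<Omega> \<phi> \<Longrightarrow> square_integrable \<mu> (grad \<phi>)"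
  by (rule square_integrable_grad[OF test_fun_smooth])

lemma integral_grad_test_eq_0:
  assumes "test_fun \<Omega> \<phi>"
  shows "(LINT x|\<mu>. grad \<phi> x \<bullet> a) = 0"
proof -
  obtain S where S: "compact S" "S \<subseteq> \<Omega>" "\<And>x. x \<notin> S \<Longrightarrow> \<phi> x = 0"
    using assms by (metis test_funE)
  have cont: "continuous_on UNIV (\<lambda>x. grad \<phi> x \<bullet> a)"
    using assms by (intro continuous_intros continuous_on_grad test_fun_smooth)
  have "grad \<phi> x = 0" if "x \<notin> S" for x
    using has_derivative_0_outside[OF compact_imp_closed[OF S(1)] S(3) that]
    by (intro grad_eqI) simp
  then have "indicator \<Omega> x *\<^sub>R (grad \<phi> x \<bullet> a) = grad \<phi> x \<bullet> a" for x
    using S(2) by (cases "x \<in> S") (auto simp: indicator_def)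
  then have "(LINT x|\<mu>. grad \<phi> x \<bullet> a) = (LINT x|lebesgue. grad \<phi> x \<bullet> a)"
    by (simp add: integral_restrict_space del: real_scaleR_def)
  also have "\<dots> = (LINT x|lborel. grad \<phi> x \<bullet> a)"
    using borel_measurable_continuous_onI[OF cont] by (intro integral_completion) simp
  also have "\<dots> = 0"
    using has_derivative_grad[OF test_fun_differentiable[OF assms]] cont S(1,3)
    by (rule integral_directional_derivative_eq_0)
  finally show ?thesis .
qed

lemma integration_by_parts:
  assumes \<phi>: "test_fun \<Omega> \<phi>" and f: "smooth_fun f"
  shows "L2_inner \<mu> f (\<lambda>x. grad \<phi> x \<bullet> a) = - L2_inner \<mu> \<phi> (\<lambda>x. grad f x \<bullet> a)"
proof -
  have sq: "square_integrable \<mu> f" "square_integrable \<mu> (\<lambda>x. grad \<phi> x \<bullet> a)"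
    "square_integrable \<mu> \<phi>" "square_integrable \<mu> (\<lambda>x. grad f x \<bullet> a)"
    using assms by (auto intro: square_integrable_smooth square_integrable_partial test_fun_smooth)
  have "0 = (LINT x|\<mu>. grad (\<lambda>x. \<phi> x * f x) x \<bullet> a)"
    using integral_grad_test_eq_0[OF test_fun_mult_smooth[OF assms]] by simp
  also have "\<dots> = (LINT x|\<mu>. \<phi> x \<bullet> (grad f x \<bullet> a) + f x \<bullet> (grad \<phi> x \<bullet> a))"
    by (simp add: grad_mult inner_add_left test_fun_differentiable[OF \<phi>]
        smooth_fun_differentiable[OF f])
  also have "\<dots> = L2_inner \<mu> \<phi> (\<lambda>x. grad f x \<bullet> a) + L2_inner \<mu> f (\<lambda>x. grad \<phi> x \<bullet> a)"
    unfolding L2_inner_def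
    by (intro Bochner_Integration.integral_add integrable_inner_square_integrable sq)
  finally show ?thesis by linarith
qed

text \<open>Integrate \<open>\<phi>\<^sup>2\<close> by parts against the field \<open>(a \<bullet> x - (b1 + b2) / 2) a\<close>,
  whose divergence is 1.\<close>

lemma poincare_slab:
  assumes \<phi>: "test_fun \<Omega> \<phi>" and a: "norm a = 1" and slab: "\<Omega> \<subseteq> slab a b1 b2"
  shows "L2_sqnorm \<mu> \<phi> \<le> (b2 - b1)\<^sup>2 * L2_sqnorm \<mu> (grad \<phi>)"
proof -
  define f where "f x = a \<bullet> x - (b1 + b2) / 2" for x
  define h where "h x = (- 2 * f x) * (grad \<phi> x \<bullet> a)" for x
  have f: "smooth_fun f"
    unfolding f_def by (intro smooth_fun_diff smooth_fun_const smooth_fun_inner)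
  have grad_f: "grad f x \<bullet> a = 1" for x
    using a by (simp add: f_def[abs_def] grad_diff smooth_fun_differentiable smooth_fun_inner
        grad_inner grad_const norm_eq_1)
  have h: "square_integrable \<mu> h"
    unfolding h_def using f test_fun_smooth[OF \<phi>]
    by (intro square_integrable_continuous continuous_intros continuous_on_grad
        smooth_fun_continuous_on)
  have sq: "square_integrable \<mu> \<phi>" "square_integrable \<mu> (grad \<phi>)"
    using \<phi> by (auto intro: square_integrable_test square_integrable_grad_test)
  have "L2_sqnorm \<mu> \<phi> = L2_inner \<mu> (\<lambda>x. \<phi> x * \<phi> x) (\<lambda>x. grad f x \<bullet> a)"
    by (simp add: L2_sqnorm_def L2_inner_def grad_f power2_eq_square)
  also have "\<dots> = - L2_inner \<mu> f (\<lambda>x. grad (\<lambda>x. \<phi> x * \<phi> x) x \<bullet> a)"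
    using integration_by_parts[OF test_fun_mult_smooth[OF \<phi> test_fun_smooth[OF \<phi>]] f] by simp
  also have "\<dots> = L2_inner \<mu> h \<phi>"
    using \<phi> by (simp add: L2_inner_def h_def grad_mult test_fun_differentiable inner_add_left
        algebra_simps flip: integral_minus)
  finally have "L2_sqnorm \<mu> \<phi> \<le> L2_sqnorm \<mu> h"
    using h sq by (intro L2_sqnorm_le_if_le_L2_inner) auto
  also have "\<dots> \<le> L2_sqnorm \<mu> (\<lambda>x. (b2 - b1) *\<^sub>R grad \<phi> x)"
  proof (intro L2_sqnorm_mono AE_I2)
    fix x assume "x \<in> space \<mu>"
    then have "x \<in> slab a b1 b2" using slab by auto
    then have "\<bar>2 * f x\<bar> \<le> \<bar>b2 - b1\<bar>" unfolding f_def slab_def by (auto simp: field_simps)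
    moreover have "\<bar>grad \<phi> x \<bullet> a\<bar> \<le> norm (grad \<phi> x)"
      using Cauchy_Schwarz_ineq2[of "grad \<phi> x" a] a by simp
    ultimately show "norm (h x) \<le> norm ((b2 - b1) *\<^sub>R grad \<phi> x)"
      unfolding h_def norm_scaleR real_norm_def abs_mult[of _ "grad \<phi> x \<bullet> a"]
      by (intro mult_mono) auto
  qed (use h sq square_integrable_scaleR in auto)
  finally show ?thesis by (simp add: L2_sqnorm_scaleR)
qed

definition H1_tendsto :: "(nat \<Rightarrow> 'a \<Rightarrow> real) \<Rightarrow> ('a \<Rightarrow> real) \<Rightarrow> ('a \<Rightarrow> 'a) \<Rightarrow> bool" where
  "H1_tendsto \<phi> u g \<longleftrightarrow> L2_tendsto \<mu> \<phi> u \<and> L2_tendsto \<mu> (\<lambda>k. grad (\<phi> k)) g"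

lemma H1_tendsto_const: "smooth_fun f \<Longrightarrow> H1_tendsto (\<lambda>k. f) f (grad f)"
  by (simp add: H1_tendsto_def L2_tendsto_const square_integrable_smooth square_integrable_grad)

lemma H1_tendsto_diff:
  assumes "H1_tendsto \<phi> u g" "H1_tendsto \<psi> u' g'"
    and smooth: "\<And>k. smooth_fun (\<phi> k)" "\<And>k. smooth_fun (\<psi> k)"
  shows "H1_tendsto (\<lambda>k x. \<phi> k x - \<psi> k x) (\<lambda>x. u x - u' x) (\<lambda>x. g x - g' x)"
proof -
  have "grad (\<lambda>x. \<phi> k x - \<psi> k x) = (\<lambda>x. grad (\<phi> k) x - grad (\<psi> k) x)" for k
    using smooth by (intro ext grad_diff smooth_fun_differentiable)
  then show ?thesis using assms(1,2) by (simp add: H1_tendsto_def L2_tendsto_diff)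
qed

definition H10 :: "('a \<Rightarrow> real) \<Rightarrow> ('a \<Rightarrow> 'a) \<Rightarrow> bool" where
  "H10 u g \<longleftrightarrow> (\<exists>\<phi>. (\<forall>k. test_fun \<Omega> (\<phi> k)) \<and> H1_tendsto \<phi> u g)"

lemma H10_square_integrable:
  assumes "H10 u g"
  shows "square_integrable \<mu> u" "square_integrable \<mu> g"
  using assms by (auto simp: H10_def H1_tendsto_def L2_tendsto_def)

lemma H10_test_fun: "test_fun \<Omega> \<phi> \<Longrightarrow> H10 \<phi> (grad \<phi>)"
  unfolding H10_def by (intro exI[of _ "\<lambda>k. \<phi>"]) (simp add: H1_tendsto_const test_fun_smooth)

lemma H10_diff:
  assumes "H10 u g" "H10 u' g'"
  shows "H10 (\<lambda>x. u x - u' x) (\<lambda>x. g x - g' x)"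
proof -
  obtain \<phi> \<psi> where \<phi>: "\<And>k. test_fun \<Omega> (\<phi> k)" "H1_tendsto \<phi> u g"
    and \<psi>: "\<And>k. test_fun \<Omega> (\<psi> k)" "H1_tendsto \<psi> u' g'"
    using assms unfolding H10_def by blast
  show ?thesis
    unfolding H10_def using test_fun_diff[OF \<phi>(1) \<psi>(1)]
      H1_tendsto_diff[OF \<phi>(2) \<psi>(2) test_fun_smooth[OF \<phi>(1)] test_fun_smooth[OF \<psi>(1)]]
    by (intro exI[of _ "\<lambda>k x. \<phi> k x - \<psi> k x"]) simp
qed

lemma H10_cong_AE:
  assumes "H10 u g" "square_integrable \<mu> u'" "AE x in \<mu>. u x = u' x"
  shows "H10 u' g"
  using assms L2_tendsto_cong_AE unfolding H10_def H1_tendsto_def by blast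

lemma poincare:
  assumes "H10 u g"
  shows "L2_sqnorm \<mu> u \<le> (slab_diam \<Omega>)\<^sup>2 * L2_sqnorm \<mu> g"
proof -
  obtain a b1 b2 where slab: "\<And>n::nat. norm (a n) = 1" "\<And>n. \<Omega> \<subseteq> slab (a n) (b1 n) (b2 n)"
    and lim: "(\<lambda>n. b2 n - b1 n) \<longlonglongrightarrow> slab_diam \<Omega>"
    using slab_diam_sequence[OF bounded_\<Omega> nonempty_\<Omega>] by metis
  have test: "L2_sqnorm \<mu> \<phi> \<le> (slab_diam \<Omega>)\<^sup>2 * L2_sqnorm \<mu> (grad \<phi>)" if "test_fun \<Omega> \<phi>" for \<phi>
  proof (rule LIMSEQ_le_const)
    show "(\<lambda>n. (b2 n - b1 n)\<^sup>2 * L2_sqnorm \<mu> (grad \<phi>)) \<longlonglongrightarrow> (slab_diam \<Omega>)\<^sup>2 * L2_sqnorm \<mu> (grad \<phi>)"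
      by (intro tendsto_intros lim)
  qed (use poincare_slab[OF that slab] in blast)
  obtain \<phi> where \<phi>: "\<And>k. test_fun \<Omega> (\<phi> k)"
    and lim: "L2_tendsto \<mu> \<phi> u" "L2_tendsto \<mu> (\<lambda>k. grad (\<phi> k)) g"
    using assms unfolding H10_def H1_tendsto_def by blast
  show ?thesis
    using L2_tendsto_sqnorm[OF lim(1)] tendsto_mult_left[OF L2_tendsto_sqnorm[OF lim(2)]]
    by (rule LIMSEQ_le) (use test[OF \<phi>] in auto)
qed

lemma H10_limit_exists:
  assumes \<phi>: "\<And>k. test_fun \<Omega> (\<phi> k)" and cauchy: "L2_Cauchy \<mu> (\<lambda>k. grad (\<phi> k))"
  obtains u g where "H10 u g" "L2_tendsto \<mu> (\<lambda>k. grad (\<phi> k)) g"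
proof -
  have "L2_Cauchy \<mu> \<phi>"
    using cauchy square_integrable_test[OF \<phi>] zero_le_power2
      poincare[OF H10_diff[OF H10_test_fun[OF \<phi>] H10_test_fun[OF \<phi>]]]
    by (rule L2_Cauchy_dominated_sqnorm)
  then obtain u where u: "L2_tendsto \<mu> \<phi> u" by (rule L2_Cauchy_convergent)
  obtain g where g: "L2_tendsto \<mu> (\<lambda>k. grad (\<phi> k)) g" using L2_Cauchy_convergent[OF cauchy] .
  have "H10 u g" unfolding H10_def H1_tendsto_def using \<phi> u g by blast
  then show ?thesis using g by (rule that)
qed

lemma H10_integration_by_parts:
  assumes "H10 u g" and \<theta>: "test_fun \<Omega> \<theta>"
  shows "L2_inner \<mu> u (\<lambda>x. grad \<theta> x \<bullet> a) = - L2_inner \<mu> g (\<lambda>x. \<theta> x *\<^sub>R a)"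
proof -
  obtain \<phi> where \<phi>: "\<And>k. test_fun \<Omega> (\<phi> k)" "L2_tendsto \<mu> \<phi> u" "L2_tendsto \<mu> (\<lambda>k. grad (\<phi> k)) g"
    using assms(1) unfolding H10_def H1_tendsto_def by blast
  have sq: "square_integrable \<mu> (\<lambda>x. grad \<theta> x \<bullet> a)" "square_integrable \<mu> (\<lambda>x. \<theta> x *\<^sub>R a)"
    using test_fun_smooth[OF \<theta>] square_integrable_partial
    by (blast, intro square_integrable_continuous continuous_intros smooth_fun_continuous_on)
  have "L2_inner \<mu> (\<phi> k) (\<lambda>x. grad \<theta> x \<bullet> a) = - L2_inner \<mu> (grad (\<phi> k)) (\<lambda>x. \<theta> x *\<^sub>R a)" for k
    using integration_by_parts[OF \<theta> test_fun_smooth[OF \<phi>(1)]] by (simp add: L2_inner_def)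
  then have "(\<lambda>k. L2_inner \<mu> (\<phi> k) (\<lambda>x. grad \<theta> x \<bullet> a)) \<longlonglongrightarrow> - L2_inner \<mu> g (\<lambda>x. \<theta> x *\<^sub>R a)"
    using tendsto_minus[OF L2_tendsto_inner[OF \<phi>(3) sq(2)]] by simp
  with L2_tendsto_inner[OF \<phi>(2) sq(1)] show ?thesis by (rule LIMSEQ_unique)
qed

lemma H10_imp_weak_grad:
  assumes H10: "H10 u g"
  shows "weak_grad \<Omega> u g"
  unfolding weak_grad_def set_integrable_iff_integrable_\<mu> set_integral_eq_integral_\<mu>
proof (intro allI impI conjI)
  fix \<theta> assume \<theta>: "test_fun \<Omega> \<theta>"
  show int: "integrable \<mu> (\<lambda>x. u x *\<^sub>R grad \<theta> x)" "integrable \<mu> (\<lambda>x. \<theta> x *\<^sub>R g x)"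
    using H10_square_integrable[OF H10] square_integrable_test[OF \<theta>]
      square_integrable_grad_test[OF \<theta>] by (auto intro: integrable_scaleR_square_integrable)
  show "(LINT x|\<mu>. u x *\<^sub>R grad \<theta> x) = - (LINT x|\<mu>. \<theta> x *\<^sub>R g x)"
  proof (rule euclidean_eqI)
    fix i :: 'a
    have "(LINT x|\<mu>. u x *\<^sub>R grad \<theta> x) \<bullet> i = L2_inner \<mu> u (\<lambda>x. grad \<theta> x \<bullet> i)"
      using integral_inner_left[OF int(1), of i] by (simp add: L2_inner_def)
    also have "\<dots> = - L2_inner \<mu> g (\<lambda>x. \<theta> x *\<^sub>R i)"
      using H10 \<theta> by (rule H10_integration_by_parts)
    also have "\<dots> = (- (LINT x|\<mu>. \<theta> x *\<^sub>R g x)) \<bullet> i"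
      using integral_inner_left[OF int(2), of i] by (simp add: L2_inner_def)
    finally show "(LINT x|\<mu>. u x *\<^sub>R grad \<theta> x) \<bullet> i = (- (LINT x|\<mu>. \<theta> x *\<^sub>R g x)) \<bullet> i" .
  qed
qed

lemma H10_imp_W120: "H10 u g \<Longrightarrow> W120 \<Omega> u g"
  using H10_imp_weak_grad[of u g]
  by (auto simp: W120_def H10_def H1_tendsto_def L2_tendsto_def L2_sqnorm_def
      L2_on_iff_square_integrable set_integral_eq_integral_\<mu>)

end

section \<open>The linear Dirichlet problem\<close>

lemma linear_coeff_eq_0_if_nonneg:
  fixes A B :: real
  assumes "\<And>t. 0 \<le> t * A + t\<^sup>2 * B"
  shows "A = 0"
proof (rule DERIV_local_min[of "\<lambda>t. t * A + t\<^sup>2 * B" A 0 1])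
  show "((\<lambda>t. t * A + t\<^sup>2 * B) has_real_derivative A) (at 0)"
    by (auto intro!: derivative_eq_intros)
qed (use assms in auto)

context bounded_open_set
begin

definition poisson :: "('a \<Rightarrow> real) \<Rightarrow> ('a \<Rightarrow> real) \<Rightarrow> ('a \<Rightarrow> 'a) \<Rightarrow> bool" where
  "poisson F u g \<longleftrightarrow> H10 u g \<and>
     (\<forall>\<phi>. test_fun \<Omega> \<phi> \<longrightarrow> L2_inner \<mu> g (grad \<phi>) = L2_inner \<mu> F \<phi>)"

definition energy :: "('a \<Rightarrow> real) \<Rightarrow> ('a \<Rightarrow> real) \<Rightarrow> real" where
  "energy F \<phi> = L2_sqnorm \<mu> (grad \<phi>) / 2 - L2_inner \<mu> F \<phi>"

lemma energy_add_cmult: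
  assumes F: "square_integrable \<mu> F" and \<phi>: "test_fun \<Omega> \<phi>" and \<theta>: "test_fun \<Omega> \<theta>"
  shows "energy F (\<lambda>x. \<phi> x + t * \<theta> x) = energy F \<phi>
    + t * (L2_inner \<mu> (grad \<phi>) (grad \<theta>) - L2_inner \<mu> F \<theta>) + t\<^sup>2 / 2 * L2_sqnorm \<mu> (grad \<theta>)"
proof -
  note sq = square_integrable_test[OF \<phi>] square_integrable_test[OF \<theta>]
  have "grad (\<lambda>x. \<phi> x + t * \<theta> x) = (\<lambda>x. grad \<phi> x + t *\<^sub>R grad \<theta> x)"
    using test_fun_differentiable[OF \<phi>] test_fun_differentiable[OF \<theta>]
    by (intro ext) (simp add: grad_add grad_cmult)
  moreover have "L2_inner \<mu> F (\<lambda>x. \<phi> x + t *\<^sub>R \<theta> x) = L2_inner \<mu> F \<phi> + t * L2_inner \<mu> F \<theta>"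
    using F sq L2_inner_add_left[OF sq(1) square_integrable_scaleR[OF sq(2)] F, of t]
    by (simp only: L2_inner_commute[of \<mu> F] L2_inner_scaleR_left)
  ultimately show ?thesis
    using L2_sqnorm_add_scaleR[of \<mu> "grad \<phi>" "grad \<theta>" t] \<phi> \<theta>
    by (simp add: energy_def square_integrable_grad_test field_simps)
qed

lemma energy_bdd_below:
  assumes F: "square_integrable \<mu> F"
  shows "bdd_below (energy F ` Collect (test_fun \<Omega>))"
proof -
  have "- ((slab_diam \<Omega>)\<^sup>2 * L2_sqnorm \<mu> F / 2) \<le> energy F \<phi>" if \<phi>: "test_fun \<Omega> \<phi>" for \<phi>
  proof -
    define A N where "A = (slab_diam \<Omega>)\<^sup>2 * L2_sqnorm \<mu> F" and "N = L2_sqnorm \<mu> (grad \<phi>)"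
    have "0 \<le> A" "0 \<le> N" by (simp_all add: A_def N_def L2_sqnorm_nonneg)
    have "(L2_inner \<mu> F \<phi>)\<^sup>2 \<le> L2_sqnorm \<mu> F * L2_sqnorm \<mu> \<phi>"
      by (rule L2_Cauchy_Schwarz[OF F square_integrable_test[OF \<phi>]])
    also have "\<dots> \<le> L2_sqnorm \<mu> F * ((slab_diam \<Omega>)\<^sup>2 * N)"
      unfolding N_def by (intro mult_left_mono poincare H10_test_fun \<phi> L2_sqnorm_nonneg)
    also have "\<dots> = A * N" by (simp add: A_def)
    also have "\<dots> \<le> ((A + N) / 2)\<^sup>2"
      using zero_le_power2[of "A - N"] by (simp add: power2_eq_square field_simps)
    finally have "L2_inner \<mu> F \<phi> \<le> (A + N) / 2"
      by (rule power2_le_imp_le) (use \<open>0 \<le> A\<close> \<open>0 \<le> N\<close> in simp)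
    then show ?thesis by (simp add: energy_def A_def N_def field_simps)
  qed
  then show ?thesis by (intro bdd_belowI2) auto
qed

lemma minimising_sequence_exists:
  assumes F: "square_integrable \<mu> F"
  obtains \<phi> m where "\<And>k. test_fun \<Omega> (\<phi> k)" "(\<lambda>k. energy F (\<phi> k)) \<longlonglongrightarrow> m"
    "\<And>\<theta>. test_fun \<Omega> \<theta> \<Longrightarrow> m \<le> energy F \<theta>"
proof -
  let ?E = "energy F ` Collect (test_fun \<Omega>)"
  have "?E \<noteq> {}" using test_fun_0 by blast
  then obtain e where e: "\<And>k. e k \<in> ?E" "e \<longlonglongrightarrow> Inf ?E"
    using energy_bdd_below[OF F] by (rule cInf_sequence) blast
  then have "\<forall>k. \<exists>\<phi>. test_fun \<Omega> \<phi> \<and> e k = energy F \<phi>" by blast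
  then obtain \<phi> where \<phi>: "\<And>k. test_fun \<Omega> (\<phi> k)" "\<And>k. e k = energy F (\<phi> k)" by metis
  have "(\<lambda>k. energy F (\<phi> k)) \<longlonglongrightarrow> Inf ?E" using e(2) by (simp flip: \<phi>(2))
  moreover have "Inf ?E \<le> energy F \<theta>" if "test_fun \<Omega> \<theta>" for \<theta>
    using that by (intro cInf_lower energy_bdd_below[OF F]) simp
  ultimately show ?thesis using \<phi>(1) that by blast
qed

text \<open>The parallelogram law, with the midpoint of \<open>\<phi>\<close> and \<open>\<psi>\<close> as competitor.\<close>

lemma near_minimisers_close:
  assumes F: "square_integrable \<mu> F" and m: "\<And>\<theta>. test_fun \<Omega> \<theta> \<Longrightarrow> m \<le> energy F \<theta>"
    and \<phi>: "test_fun \<Omega> \<phi>" and \<psi>: "test_fun \<Omega> \<psi>"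
  shows "L2_sqnorm \<mu> (\<lambda>x. grad \<phi> x - grad \<psi> x) \<le> 4 * (energy F \<phi> - m) + 4 * (energy F \<psi> - m)"
proof -
  define \<theta> where "\<theta> x = \<phi> x - \<psi> x" for x
  have \<theta>: "test_fun \<Omega> \<theta>" unfolding \<theta>_def using \<phi> \<psi> by (rule test_fun_diff)
  have grad_\<theta>: "grad \<theta> = (\<lambda>x. grad \<phi> x - grad \<psi> x)"
    unfolding \<theta>_def using \<phi> \<psi> by (intro ext grad_diff test_fun_differentiable)
  have "m \<le> energy F (\<lambda>x. \<psi> x + 1/2 * \<theta> x)"
    using \<psi> \<theta> by (intro m test_fun_add test_fun_cmult)
  moreover have "energy F \<phi> = energy F (\<lambda>x. \<psi> x + 1 * \<theta> x)" by (simp add: \<theta>_def)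
  ultimately show ?thesis
    unfolding energy_add_cmult[OF F \<psi> \<theta>] grad_\<theta>[symmetric]
    by (simp add: power2_eq_square field_simps)
qed

lemma minimising_sequence_Cauchy:
  assumes F: "square_integrable \<mu> F" and m: "\<And>\<theta>. test_fun \<Omega> \<theta> \<Longrightarrow> m \<le> energy F \<theta>"
    and \<phi>: "\<And>k. test_fun \<Omega> (\<phi> k)" and lim: "(\<lambda>k. energy F (\<phi> k)) \<longlonglongrightarrow> m"
  shows "L2_Cauchy \<mu> (\<lambda>k. grad (\<phi> k))"
  unfolding L2_Cauchy_def
proof (intro conjI allI impI square_integrable_grad_test \<phi>)
  fix e :: real assume "e > 0"
  then have "\<forall>\<^sub>F k in sequentially. energy F (\<phi> k) < m + e / 8"
    using lim by (intro order_tendstoD) auto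
  then obtain N where N: "\<And>k. k \<ge> N \<Longrightarrow> energy F (\<phi> k) < m + e / 8"
    by (auto simp: eventually_sequentially)
  have "L2_sqnorm \<mu> (\<lambda>x. grad (\<phi> i) x - grad (\<phi> j) x) < e" if "i \<ge> N" "j \<ge> N" for i j
    using near_minimisers_close[OF F m \<phi> \<phi>, of i j] N[OF that(1)] N[OF that(2)] by simp
  then show "\<exists>N. \<forall>i\<ge>N. \<forall>j\<ge>N. L2_sqnorm \<mu> (\<lambda>x. grad (\<phi> i) x - grad (\<phi> j) x) < e" by blast
qed

lemma minimising_sequence_limit_weak_solution:
  assumes F: "square_integrable \<mu> F" and m: "\<And>\<theta>. test_fun \<Omega> \<theta> \<Longrightarrow> m \<le> energy F \<theta>"
    and \<phi>: "\<And>k. test_fun \<Omega> (\<phi> k)" and lim: "(\<lambda>k. energy F (\<phi> k)) \<longlonglongrightarrow> m"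
    and g: "L2_tendsto \<mu> (\<lambda>k. grad (\<phi> k)) g" and \<theta>: "test_fun \<Omega> \<theta>"
  shows "L2_inner \<mu> g (grad \<theta>) = L2_inner \<mu> F \<theta>"
proof -
  define N where "N = L2_sqnorm \<mu> (grad \<theta>)"
  have "0 \<le> t * (L2_inner \<mu> g (grad \<theta>) - L2_inner \<mu> F \<theta>) + t\<^sup>2 * (N / 2)" for t
  proof -
    define r where "r k = energy F (\<phi> k)
      + t * (L2_inner \<mu> (grad (\<phi> k)) (grad \<theta>) - L2_inner \<mu> F \<theta>) + t\<^sup>2 * (N / 2)" for k
    have "m \<le> r k" for k
      using m[OF test_fun_add[OF \<phi> test_fun_cmult[OF \<theta>]], of k t]
      by (simp add: energy_add_cmult[OF F \<phi> \<theta>] r_def N_def)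
    moreover have "r \<longlonglongrightarrow> m + t * (L2_inner \<mu> g (grad \<theta>) - L2_inner \<mu> F \<theta>) + t\<^sup>2 * (N / 2)"
      unfolding r_def
      by (intro tendsto_intros lim L2_tendsto_inner[OF g square_integrable_grad_test[OF \<theta>]])
    ultimately have "m \<le> m + t * (L2_inner \<mu> g (grad \<theta>) - L2_inner \<mu> F \<theta>) + t\<^sup>2 * (N / 2)"
      by (intro LIMSEQ_le_const) auto
    then show ?thesis by linarith
  qed
  then show ?thesis using linear_coeff_eq_0_if_nonneg by fastforce
qed

lemma poisson_exists:
  assumes F: "square_integrable \<mu> F"
  obtains u g where "poisson F u g"
proof -
  obtain \<phi> m where \<phi>: "\<And>k. test_fun \<Omega> (\<phi> k)" "(\<lambda>k. energy F (\<phi> k)) \<longlonglongrightarrow> m"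
    and m: "\<And>\<theta>. test_fun \<Omega> \<theta> \<Longrightarrow> m \<le> energy F \<theta>"
    using minimising_sequence_exists[OF F] by blast
  obtain u g where "H10 u g" and g: "L2_tendsto \<mu> (\<lambda>k. grad (\<phi> k)) g"
    using H10_limit_exists[OF \<phi>(1) minimising_sequence_Cauchy[OF F m \<phi>]] .
  then have "poisson F u g"
    using minimising_sequence_limit_weak_solution[OF F m \<phi> g] by (simp add: poisson_def)
  then show ?thesis by (rule that)
qed

lemma poisson_H10: "poisson F u g \<Longrightarrow> H10 u g"
  by (simp add: poisson_def)

lemma poisson_test_H10:
  assumes "poisson F u g" "square_integrable \<mu> F" "H10 v k"
  shows "L2_inner \<mu> g k = L2_inner \<mu> F v"
proof -
  obtain \<phi> where \<phi>: "\<And>k. test_fun \<Omega> (\<phi> k)" "L2_tendsto \<mu> \<phi> v" "L2_tendsto \<mu> (\<lambda>k. grad (\<phi> k)) k"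
    using assms(3) unfolding H10_def H1_tendsto_def by blast
  have "L2_inner \<mu> (grad (\<phi> n)) g = L2_inner \<mu> (\<phi> n) F" for n
    using assms(1) \<phi>(1) by (simp add: poisson_def L2_inner_commute)
  then have "L2_inner \<mu> k g = L2_inner \<mu> v F"
    using LIMSEQ_unique[OF L2_tendsto_inner[OF \<phi>(2) assms(2)]]
      L2_tendsto_inner[OF \<phi>(3) H10_square_integrable(2)[OF poisson_H10[OF assms(1)]]] by simp
  then show ?thesis by (simp add: L2_inner_commute)
qed

lemma poisson_stable:
  assumes p: "poisson F u g" "poisson F' u' g'"
    and F: "square_integrable \<mu> F" "square_integrable \<mu> F'"
  shows "L2_sqnorm \<mu> (\<lambda>x. u x - u' x) \<le> (slab_diam \<Omega>) ^ 4 * L2_sqnorm \<mu> (\<lambda>x. F x - F' x)"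
proof -
  define w k D
    where "w = (\<lambda>x. u x - u' x)" and "k = (\<lambda>x. g x - g' x)" and "D = (\<lambda>x. F x - F' x)"
  define C where "C = (slab_diam \<Omega>)\<^sup>2"
  have H10: "H10 w k"
    unfolding w_def k_def using p by (intro H10_diff poisson_H10)
  have sq: "square_integrable \<mu> w" "square_integrable \<mu> k" "square_integrable \<mu> D"
    using H10_square_integrable[OF H10] square_integrable_diff[OF F] by (auto simp: D_def)
  have "L2_sqnorm \<mu> k = L2_inner \<mu> g k - L2_inner \<mu> g' k"
    using L2_inner_diff_left[OF H10_square_integrable(2)[OF poisson_H10[OF p(1)]]
        H10_square_integrable(2)[OF poisson_H10[OF p(2)]] sq(2), folded k_def]
    by (simp add: L2_inner_self)
  also have "\<dots> = L2_inner \<mu> F w - L2_inner \<mu> F' w"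
    using p F H10 by (simp add: poisson_test_H10)
  also have "\<dots> = L2_inner \<mu> D w"
    unfolding D_def by (rule L2_inner_diff_left[symmetric, OF F sq(1)])
  finally have "L2_sqnorm \<mu> k * L2_sqnorm \<mu> k \<le> L2_sqnorm \<mu> D * L2_sqnorm \<mu> w"
    using L2_Cauchy_Schwarz[OF sq(3,1)] by (simp add: power2_eq_square)
  also have "\<dots> \<le> L2_sqnorm \<mu> D * (C * L2_sqnorm \<mu> k)"
    unfolding C_def by (intro mult_left_mono poincare H10 L2_sqnorm_nonneg)
  finally have "L2_sqnorm \<mu> k \<le> C * L2_sqnorm \<mu> D"
    using L2_sqnorm_nonneg[of \<mu> D] L2_sqnorm_nonneg[of \<mu> k]
    by (cases "L2_sqnorm \<mu> k = 0") (auto simp: C_def mult_le_cancel_right ac_simps)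
  then have "C * L2_sqnorm \<mu> k \<le> C * (C * L2_sqnorm \<mu> D)"
    by (rule mult_left_mono) (simp add: C_def)
  moreover have "L2_sqnorm \<mu> w \<le> C * L2_sqnorm \<mu> k"
    unfolding C_def using H10 by (rule poincare)
  ultimately show ?thesis
    by (simp add: w_def D_def C_def flip: power_mult mult.assoc power_add)
qed

lemma poisson_limit:
  assumes "\<And>n. poisson (F n) (u n) (g n)" and F: "L2_tendsto \<mu> F F'" and u: "L2_tendsto \<mu> u u'"
  obtains g' where "poisson F' u' g'"
proof -
  have sq: "square_integrable \<mu> (F n)" "square_integrable \<mu> F'" for n
    using F by (auto simp: L2_tendsto_def)
  obtain v g' where v: "poisson F' v g'" using poisson_exists[OF sq(2)] .
  have "L2_tendsto \<mu> u v"
  proof (rule L2_tendsto_dominated_sqnorm[OF F _ _ poisson_stable[OF assms(1) v sq]])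
  qed (use u v in \<open>auto simp: L2_tendsto_def intro: H10_square_integrable poisson_H10\<close>)
  then have "AE x in \<mu>. v x = u' x" using u by (rule L2_tendsto_unique_AE)
  then have "H10 u' g'"
    using poisson_H10[OF v] u by (auto simp: L2_tendsto_def intro: H10_cong_AE)
  then have "poisson F' u' g'" using v by (simp add: poisson_def)
  then show ?thesis by (rule that)
qed

section \<open>The weak maximum principle\<close>

definition nonpos_near_boundary :: "('a \<Rightarrow> real) \<Rightarrow> bool" where
  "nonpos_near_boundary D \<longleftrightarrow> (\<exists>S. compact S \<and> S \<subseteq> \<Omega> \<and> (\<forall>x\<in>\<Omega> - S. D x \<le> 0))"

definition weakly_nonpos_on_boundary :: "('a \<Rightarrow> real) \<Rightarrow> ('a \<Rightarrow> 'a) \<Rightarrow> bool" where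
  "weakly_nonpos_on_boundary w q \<longleftrightarrow> (\<exists>D. (\<forall>k. smooth_fun (D k) \<and> nonpos_near_boundary (D k))
     \<and> H1_tendsto D w q)"

lemma weakly_nonpos_on_boundary_H10_diff_smooth:
  assumes "H10 u g" and w: "smooth_fun w" "\<And>x. x \<in> \<Omega> \<Longrightarrow> 0 \<le> w x"
  shows "weakly_nonpos_on_boundary (\<lambda>x. u x - w x) (\<lambda>x. g x - grad w x)"
proof -
  obtain \<phi> where \<phi>: "\<And>k. test_fun \<Omega> (\<phi> k)" "H1_tendsto \<phi> u g"
    using assms(1) unfolding H10_def by blast
  have "nonpos_near_boundary (\<lambda>x. \<phi> k x - w x)" for k
  proof -
    obtain S where "compact S" "S \<subseteq> \<Omega>" "\<And>x. x \<notin> S \<Longrightarrow> \<phi> k x = 0"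
      using \<phi>(1) by (metis test_funE)
    then show ?thesis unfolding nonpos_near_boundary_def using w(2) by (intro exI[of _ S]) auto
  qed
  moreover have "smooth_fun (\<lambda>x. \<phi> k x - w x)" for k
    by (rule smooth_fun_diff[OF test_fun_smooth[OF \<phi>(1)] w(1)])
  ultimately show ?thesis
    unfolding weakly_nonpos_on_boundary_def
    using H1_tendsto_diff[OF \<phi>(2) H1_tendsto_const[OF w(1)] test_fun_smooth[OF \<phi>(1)] w(1)]
    by (intro exI[of _ "\<lambda>k x. \<phi> k x - w x"]) simp
qed

lemma H10_weakly_nonpos_on_boundary: "H10 u g \<Longrightarrow> weakly_nonpos_on_boundary u g"
  using weakly_nonpos_on_boundary_H10_diff_smooth[of u g "\<lambda>x. 0"]
  by (simp add: smooth_fun_const grad_const)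

definition smooth_truncation :: "real \<Rightarrow> ('a \<Rightarrow> real) \<Rightarrow> 'a \<Rightarrow> real" where
  "smooth_truncation \<epsilon> D x = (if x \<in> \<Omega> then smooth_pos \<epsilon> (D x) else 0)"

lemma test_fun_smooth_truncation:
  assumes "smooth_fun D" "nonpos_near_boundary D" "\<epsilon> > 0"
  shows "test_fun \<Omega> (smooth_truncation \<epsilon> D)"
proof -
  obtain S where S: "compact S" "S \<subseteq> \<Omega>" "\<And>x. x \<in> \<Omega> - S \<Longrightarrow> D x \<le> 0"
    using assms(2) unfolding nonpos_near_boundary_def by blast
  have zero: "smooth_truncation \<epsilon> D x = 0" if "x \<notin> S" for x
    using S(3) that by (auto simp: smooth_truncation_def intro: smooth_pos_eq_0)
  have "smooth_fun (smooth_truncation \<epsilon> D)"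
  proof (rule smooth_fun_local)
    fix x
    show "\<exists>T g. open T \<and> x \<in> T \<and> smooth_fun g \<and> (\<forall>y\<in>T. g y = smooth_truncation \<epsilon> D y)"
    proof (cases "x \<in> \<Omega>")
      case True
      then show ?thesis
        using open_\<Omega> smooth_fun_compose_real[OF smooth_fun_smooth_pos[OF \<open>\<epsilon> > 0\<close>] assms(1)]
        by (intro exI[of _ \<Omega>] exI[of _ "\<lambda>x. smooth_pos \<epsilon> (D x)"]) (auto simp: smooth_truncation_def)
    next
      case False
      then show ?thesis
        using S zero by (intro exI[of _ "- S"] exI[of _ "\<lambda>x. 0"])
          (auto simp: smooth_fun_const compact_imp_closed open_Compl)
    qed
  qed
  then show ?thesis using S(1,2) zero by (rule test_funI)
qed

lemma grad_smooth_truncation: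
  assumes "smooth_fun D" "\<epsilon> > 0" "x \<in> \<Omega>"
  shows "grad (smooth_truncation \<epsilon> D) x = deriv (smooth_pos \<epsilon>) (D x) *\<^sub>R grad D x"
proof -
  note smooth_pos = smooth_fun_smooth_pos[OF assms(2)]
  have "grad (smooth_truncation \<epsilon> D) x = grad (\<lambda>x. smooth_pos \<epsilon> (D x)) x"
    by (rule grad_cong_open[OF open_\<Omega> assms(3)])
      (use smooth_fun_compose_real[OF smooth_pos assms(1)]
        in \<open>auto simp: smooth_truncation_def intro: smooth_fun_differentiable\<close>)
  also have "\<dots> = deriv (smooth_pos \<epsilon>) (D x) *\<^sub>R grad D x"
    using smooth_pos assms(1) by (intro grad_compose_real smooth_fun_differentiable)
  finally show ?thesis .
qed

lemma smooth_truncation_nonneg: "0 \<le> smooth_truncation \<epsilon> D x"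
  by (simp add: smooth_truncation_def smooth_pos_nonneg)

lemma smooth_truncation_ge: "\<epsilon> > 0 \<Longrightarrow> x \<in> \<Omega> \<Longrightarrow> D x - \<epsilon> \<le> smooth_truncation \<epsilon> D x"
  by (simp add: smooth_truncation_def smooth_pos_ge)

text \<open>Since the slope of \<^const>\<open>smooth_pos\<close> lies between 0 and 1, the truncation \<open>v\<close> satisfies
  \<open>|\<nabla>v|\<^sup>2 \<le> \<nabla>D \<bullet> \<nabla>v\<close>.\<close>

lemma sqnorm_grad_smooth_truncation_le:
  assumes D: "smooth_fun D" "nonpos_near_boundary D" and "\<epsilon> > 0"
    and q: "square_integrable \<mu> q" "L2_inner \<mu> q (grad (smooth_truncation \<epsilon> D)) \<le> 0"
  shows "L2_sqnorm \<mu> (grad (smooth_truncation \<epsilon> D)) \<le> L2_sqnorm \<mu> (\<lambda>x. grad D x - q x)"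
proof (rule L2_sqnorm_le_if_le_L2_inner)
  let ?v = "smooth_truncation \<epsilon> D"
  have grad_D: "square_integrable \<mu> (grad D)" using D(1) by (rule square_integrable_grad)
  show grad_v: "square_integrable \<mu> (grad ?v)"
    using test_fun_smooth_truncation[OF D \<open>\<epsilon> > 0\<close>] by (rule square_integrable_grad_test)
  show "square_integrable \<mu> (\<lambda>x. grad D x - q x)" using grad_D q(1) by (rule square_integrable_diff)
  have "L2_sqnorm \<mu> (grad ?v) \<le> L2_inner \<mu> (grad D) (grad ?v)"
    unfolding L2_inner_self[symmetric]
  proof (intro L2_inner_le AE_I2 grad_v grad_D)
    fix x assume "x \<in> space \<mu>"
    define s where "s = deriv (smooth_pos \<epsilon>) (D x)"
    have "s * s \<le> 1 * s"
      unfolding s_def using deriv_smooth_pos_nonneg deriv_smooth_pos_le_1 \<open>\<epsilon> > 0\<close>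
      by (intro mult_right_mono)
    then have "s * s * (grad D x \<bullet> grad D x) \<le> 1 * s * (grad D x \<bullet> grad D x)"
      by (rule mult_right_mono) simp
    moreover have "grad ?v x = s *\<^sub>R grad D x"
      unfolding s_def using D(1) \<open>\<epsilon> > 0\<close> \<open>x \<in> space \<mu>\<close> by (intro grad_smooth_truncation) simp_all
    ultimately show "grad ?v x \<bullet> grad ?v x \<le> grad D x \<bullet> grad ?v x" by (simp add: mult.assoc)
  qed
  also have "\<dots> \<le> L2_inner \<mu> (\<lambda>x. grad D x - q x) (grad ?v)"
    using L2_inner_diff_left[OF grad_D q(1) grad_v] q(2) by simp
  finally show "L2_sqnorm \<mu> (grad ?v) \<le> L2_inner \<mu> (\<lambda>x. grad D x - q x) (grad ?v)" .
qed

lemma weak_maximum_principle: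
  assumes bdry: "weakly_nonpos_on_boundary w q"
    and sub: "\<And>\<theta>. test_fun \<Omega> \<theta> \<Longrightarrow> (\<And>x. 0 \<le> \<theta> x) \<Longrightarrow> L2_inner \<mu> q (grad \<theta>) \<le> 0"
  shows "AE x in \<mu>. w x \<le> 0"
proof -
  obtain D where D: "\<And>k. smooth_fun (D k)" "\<And>k. nonpos_near_boundary (D k)"
    and lim: "L2_tendsto \<mu> D w" "L2_tendsto \<mu> (\<lambda>k. grad (D k)) q"
    using bdry unfolding weakly_nonpos_on_boundary_def H1_tendsto_def by blast
  define \<epsilon> where "\<epsilon> k = inverse (real (Suc k))" for k
  define v where "v k = smooth_truncation (\<epsilon> k) (D k)" for k
  have \<epsilon>: "\<epsilon> k > 0" for k by (simp add: \<epsilon>_def)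
  have v: "test_fun \<Omega> (v k)" for k
    unfolding v_def using D \<epsilon> by (intro test_fun_smooth_truncation)
  have v_lim: "L2_tendsto \<mu> v (\<lambda>x. 0)"
  proof (rule L2_tendsto_dominated_sqnorm[OF lim(2)])
    fix k
    have "L2_sqnorm \<mu> (v k) \<le> (slab_diam \<Omega>)\<^sup>2 * L2_sqnorm \<mu> (grad (v k))"
      using v by (intro poincare H10_test_fun)
    also have "L2_sqnorm \<mu> (grad (v k)) \<le> L2_sqnorm \<mu> (\<lambda>x. grad (D k) x - q x)"
      using D \<epsilon> lim(2) sub[OF v] smooth_truncation_nonneg unfolding v_def
      by (intro sqnorm_grad_smooth_truncation_le) (auto simp: L2_tendsto_def)
    finally show "L2_sqnorm \<mu> (\<lambda>x. v k x - 0)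
        \<le> (slab_diam \<Omega>)\<^sup>2 * L2_sqnorm \<mu> (\<lambda>x. grad (D k) x - q x)"
      by (simp add: mult_left_mono)
  qed (use v in \<open>auto intro: square_integrable_test square_integrable_0\<close>)
  have "L2_tendsto \<mu> (\<lambda>k x. \<epsilon> k) (\<lambda>x. 0)"
    using LIMSEQ_inverse_real_of_nat
    by (intro L2_tendsto_dominated[of _ _ 1]) (auto simp: \<epsilon>_def field_simps)
  from L2_tendsto_diff[OF lim(1) this] have "L2_tendsto \<mu> (\<lambda>k x. D k x - \<epsilon> k) w" by simp
  then show ?thesis
    using v_lim
  proof (rule L2_tendsto_le_AE)
    show "AE x in \<mu>. D k x - \<epsilon> k \<le> v k x" for k
      unfolding v_def using \<epsilon> by (intro AE_I2 smooth_truncation_ge) auto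
  qed
qed

lemma poisson_mono:
  assumes p: "poisson F u g" "poisson F' u' g'"
    and F: "square_integrable \<mu> F" "square_integrable \<mu> F'" "AE x in \<mu>. F x \<le> F' x"
  shows "AE x in \<mu>. u x \<le> u' x"
proof -
  have "AE x in \<mu>. u x - u' x \<le> 0"
  proof (rule weak_maximum_principle)
    show "weakly_nonpos_on_boundary (\<lambda>x. u x - u' x) (\<lambda>x. g x - g' x)"
      using p by (intro H10_weakly_nonpos_on_boundary H10_diff poisson_H10)
    fix \<theta> assume \<theta>: "test_fun \<Omega> \<theta>" "\<And>x. 0 \<le> \<theta> x"
    have "L2_inner \<mu> (\<lambda>x. g x - g' x) (grad \<theta>) = L2_inner \<mu> F \<theta> - L2_inner \<mu> F' \<theta>"
      using L2_inner_diff_left[OF H10_square_integrable(2)[OF poisson_H10[OF p(1)]]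
          H10_square_integrable(2)[OF poisson_H10[OF p(2)]] square_integrable_grad_test[OF \<theta>(1)]]
        p \<theta>(1) by (simp add: poisson_def)
    also have "\<dots> \<le> 0"
      using L2_inner_mono_left[OF F(1,2) square_integrable_test[OF \<theta>(1)] F(3) \<theta>(2)] by simp
    finally show "L2_inner \<mu> (\<lambda>x. g x - g' x) (grad \<theta>) \<le> 0" .
  qed
  then show ?thesis by simp
qed

lemma poisson_nonneg:
  assumes "poisson F u g" "square_integrable \<mu> F" "AE x in \<mu>. 0 \<le> F x"
  shows "AE x in \<mu>. 0 \<le> u x"
proof -
  have "poisson (\<lambda>x. 0) (\<lambda>x. 0) (grad (\<lambda>x. 0))"
    unfolding poisson_def using H10_test_fun[OF test_fun_0]
    by (simp add: L2_inner_def grad_const)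
  then show ?thesis using assms(1) square_integrable_0 assms(2,3) by (rule poisson_mono)
qed

lemma poisson_le_supersolution:
  assumes p: "poisson F u g" and F: "square_integrable \<mu> F"
    and w: "smooth_fun w" "\<And>x. x \<in> \<Omega> \<Longrightarrow> 0 \<le> w x"
    and super: "\<And>\<theta>. test_fun \<Omega> \<theta> \<Longrightarrow> (\<And>x. 0 \<le> \<theta> x)
      \<Longrightarrow> L2_inner \<mu> F \<theta> \<le> L2_inner \<mu> (grad w) (grad \<theta>)"
  shows "AE x in \<mu>. u x \<le> w x"
proof -
  have "AE x in \<mu>. u x - w x \<le> 0"
  proof (rule weak_maximum_principle)
    show "weakly_nonpos_on_boundary (\<lambda>x. u x - w x) (\<lambda>x. g x - grad w x)"
      using p w by (intro weakly_nonpos_on_boundary_H10_diff_smooth poisson_H10)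
    fix \<theta> assume \<theta>: "test_fun \<Omega> \<theta>" "\<And>x. 0 \<le> \<theta> x"
    show "L2_inner \<mu> (\<lambda>x. g x - grad w x) (grad \<theta>) \<le> 0"
      using L2_inner_diff_left[OF H10_square_integrable(2)[OF poisson_H10[OF p]]
          square_integrable_grad[OF w(1)] square_integrable_grad_test[OF \<theta>(1)]]
        super[OF \<theta>] p \<theta>(1) by (simp add: poisson_def)
  qed
  then show ?thesis by simp
qed

text \<open>The barrier solves \<open>-\<Delta>w = A\<close> and vanishes on the two bounding hyperplanes.\<close>

definition slab_barrier :: "real \<Rightarrow> 'a \<Rightarrow> real \<Rightarrow> real \<Rightarrow> 'a \<Rightarrow> real" where
  "slab_barrier A a b1 b2 x = (A / 2 * (b2 - a \<bullet> x)) * (a \<bullet> x - b1)"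

lemma smooth_fun_slab_barrier: "smooth_fun (slab_barrier A a b1 b2)"
  unfolding slab_barrier_def[abs_def]
  by (intro smooth_fun_mult smooth_fun_diff smooth_fun_const smooth_fun_inner)

lemma slab_barrier_nonneg: "0 \<le> A \<Longrightarrow> x \<in> slab a b1 b2 \<Longrightarrow> 0 \<le> slab_barrier A a b1 b2 x"
  by (simp add: slab_barrier_def slab_def)

lemma slab_barrier_le:
  assumes "0 \<le> A"
  shows "slab_barrier A a b1 b2 x \<le> A * (b2 - b1)\<^sup>2 / 8"
proof -
  have "0 \<le> A / 2 * (((b2 - a \<bullet> x) - (a \<bullet> x - b1))\<^sup>2 / 4)" using assms by simp
  then show ?thesis by (simp add: slab_barrier_def power2_eq_square field_simps)
qed

lemma L2_inner_grad_slab_barrier: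
  assumes a: "norm a = 1" and \<theta>: "test_fun \<Omega> \<theta>"
  shows "L2_inner \<mu> (grad (slab_barrier A a b1 b2)) (grad \<theta>) = L2_inner \<mu> (\<lambda>x. A) \<theta>"
proof -
  define r where "r x = A / 2 * (b1 + b2) - A * (a \<bullet> x)" for x
  have smooth: "smooth_fun r"
    unfolding r_def by (intro smooth_fun_mult smooth_fun_diff smooth_fun_const smooth_fun_inner)
  have "grad r x = - A *\<^sub>R a" for x
    unfolding r_def by (rule grad_eqI) (auto intro!: derivative_eq_intros)
  then have grad_r: "grad r x \<bullet> a = - A" for x using a by (simp add: norm_eq_1)
  have "grad (slab_barrier A a b1 b2) x = r x *\<^sub>R a" for x
    unfolding slab_barrier_def[abs_def] r_def
    by (rule grad_eqI) (auto intro!: derivative_eq_intros simp: fun_eq_iff field_simps)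
  then have "L2_inner \<mu> (grad (slab_barrier A a b1 b2)) (grad \<theta>)
      = L2_inner \<mu> r (\<lambda>x. grad \<theta> x \<bullet> a)"
    by (simp add: L2_inner_def inner_commute)
  also have "\<dots> = - L2_inner \<mu> \<theta> (\<lambda>x. grad r x \<bullet> a)"
    using \<theta> smooth by (rule integration_by_parts)
  also have "\<dots> = L2_inner \<mu> (\<lambda>x. A) \<theta>"
    by (simp add: L2_inner_def grad_r mult.commute)
  finally show ?thesis .
qed

lemma poisson_slab_bound:
  assumes p: "poisson F u g" and F: "square_integrable \<mu> F" "AE x in \<mu>. F x \<le> A" "0 \<le> A"
    and a: "norm a = 1" and slab: "\<Omega> \<subseteq> slab a b1 b2"
  shows "AE x in \<mu>. u x \<le> A * (b2 - b1)\<^sup>2 / 8"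
proof -
  have "AE x in \<mu>. u x \<le> slab_barrier A a b1 b2 x"
  proof (rule poisson_le_supersolution[OF p F(1) smooth_fun_slab_barrier])
    show "0 \<le> slab_barrier A a b1 b2 x" if "x \<in> \<Omega>" for x
      using slab that F(3) by (intro slab_barrier_nonneg) auto
    fix \<theta> assume \<theta>: "test_fun \<Omega> \<theta>" "\<And>x. 0 \<le> \<theta> x"
    have "L2_inner \<mu> F \<theta> \<le> L2_inner \<mu> (\<lambda>x. A) \<theta>"
      using F(1) square_integrable_smooth[OF smooth_fun_const] square_integrable_test[OF \<theta>(1)]
        F(2) \<theta>(2) by (rule L2_inner_mono_left)
    then show "L2_inner \<mu> F \<theta> \<le> L2_inner \<mu> (grad (slab_barrier A a b1 b2)) (grad \<theta>)"
      by (simp add: L2_inner_grad_slab_barrier[OF a \<theta>(1)])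
  qed
  then show ?thesis by eventually_elim (rule order_trans[OF _ slab_barrier_le[OF F(3)]])
qed

end

section \<open>Essential bounds\<close>

lemma AE_le_LIMSEQ:
  fixes f :: "'x \<Rightarrow> real"
  assumes "a \<longlonglongrightarrow> l" "\<And>n::nat. AE x in M. f x \<le> a n"
  shows "AE x in M. f x \<le> l"
proof -
  have "AE x in M. \<forall>n. f x \<le> a n" using assms(2) by (simp add: AE_all_countable)
  then show ?thesis by eventually_elim (rule LIMSEQ_le_const[OF assms(1)], auto)
qed

context bounded_open_set
begin

lemma essential_bound_nonneg:
  fixes u :: "'a \<Rightarrow> real"
  assumes "AE x in \<mu>. \<bar>u x\<bar> \<le> y"
  shows "0 \<le> y"
proof (rule ccontr)
  assume "\<not> 0 \<le> y"
  with assms have "AE x in lebesgue. x \<notin> \<Omega>"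
    by (auto simp: AE_\<mu>_iff elim!: eventually_mono)
  then have "negligible \<Omega>"
    using AE_iff_null_sets[OF sets_\<Omega>] by (simp add: negligible_iff_null_sets)
  then show False using open_not_negligible[OF open_\<Omega> nonempty_\<Omega>] by simp
qed

lemma Linf_norm_eq_Inf: "Linf_norm \<Omega> u = Inf {y. AE x in \<mu>. \<bar>u x\<bar> \<le> y}"
  by (simp add: Linf_norm_def AE_\<mu>_iff)

lemma bdd_below_essential_bounds:
  fixes u :: "'a \<Rightarrow> real"
  shows "bdd_below {y. AE x in \<mu>. \<bar>u x\<bar> \<le> y}"
  by (rule bdd_belowI[of _ 0]) (blast intro: essential_bound_nonneg)

lemma AE_le_Linf_norm:
  assumes "Linf_on \<Omega> u"
  shows "AE x in \<mu>. \<bar>u x\<bar> \<le> Linf_norm \<Omega> u"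
proof -
  have "{y. AE x in \<mu>. \<bar>u x\<bar> \<le> y} \<noteq> {}" using assms by (auto simp: Linf_on_def AE_\<mu>_iff)
  then obtain y where y: "\<And>n. y n \<in> {y. AE x in \<mu>. \<bar>u x\<bar> \<le> y}"
    and lim: "y \<longlonglongrightarrow> Linf_norm \<Omega> u"
    using cInf_sequence[OF _ bdd_below_essential_bounds]
    unfolding Linf_norm_eq_Inf by blast
  show ?thesis using lim by (rule AE_le_LIMSEQ) (use y in simp)
qed

lemma Linf_norm_nonneg: "Linf_on \<Omega> u \<Longrightarrow> 0 \<le> Linf_norm \<Omega> u"
  by (rule essential_bound_nonneg[OF AE_le_Linf_norm])

lemma Linf_norm_le:
  assumes "AE x in \<mu>. \<bar>u x\<bar> \<le> y"
  shows "Linf_norm \<Omega> u \<le> y"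
  unfolding Linf_norm_eq_Inf
  using assms bdd_below_essential_bounds by (intro cInf_lower) auto

lemma poisson_slab_diam_bound:
  assumes "poisson F u g" "square_integrable \<mu> F" "AE x in \<mu>. F x \<le> A" "0 \<le> A"
  shows "AE x in \<mu>. u x \<le> A * (slab_diam \<Omega>)\<^sup>2 / 8"
proof -
  obtain a b1 b2 where slab: "\<And>n::nat. norm (a n) = 1" "\<And>n. \<Omega> \<subseteq> slab (a n) (b1 n) (b2 n)"
    and lim: "(\<lambda>n. b2 n - b1 n) \<longlonglongrightarrow> slab_diam \<Omega>"
    using slab_diam_sequence[OF bounded_\<Omega> nonempty_\<Omega>] by metis
  have "(\<lambda>n. A * (b2 n - b1 n)\<^sup>2 / 8) \<longlonglongrightarrow> A * (slab_diam \<Omega>)\<^sup>2 / 8"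
    by (intro tendsto_intros lim) simp
  then show ?thesis using poisson_slab_bound[OF assms slab] by (rule AE_le_LIMSEQ)
qed

end

section \<open>Monotone iteration\<close>

lemma lsc_nonneg_mono_LIMSEQ:
  fixes f :: "real \<Rightarrow> real"
  assumes mono: "\<And>s t. 0 \<le> s \<Longrightarrow> s \<le> t \<Longrightarrow> f s \<le> f t" and lsc: "lsc_nonneg f"
    and s: "\<And>n. 0 \<le> s n" "\<And>n. s n \<le> l" "s \<longlonglongrightarrow> l"
  shows "(\<lambda>n. f (s n)) \<longlonglongrightarrow> f l"
proof (rule LIMSEQ_I)
  fix r :: real assume "r > 0"
  have "0 \<le> l" using s(1,2)[of 0] by linarith
  then obtain \<delta> where \<delta>: "\<delta> > 0" "\<And>t. t \<ge> 0 \<Longrightarrow> \<bar>t - l\<bar> < \<delta> \<Longrightarrow> f l - r < f t"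
    using lsc \<open>r > 0\<close> unfolding lsc_nonneg_def by blast
  obtain N where "\<And>n. n \<ge> N \<Longrightarrow> norm (s n - l) < \<delta>"
    using LIMSEQ_D[OF s(3) \<delta>(1)] by blast
  then have "norm (f (s n) - f l) < r" if "n \<ge> N" for n
    using \<delta>(2)[OF s(1), of n] mono[OF s(1,2), of n] that by force
  then show "\<exists>N. \<forall>n\<ge>N. norm (f (s n) - f l) < r" by blast
qed

lemma AE_incseq_bounded_limit:
  fixes U :: "nat \<Rightarrow> 'x \<Rightarrow> real"
  assumes U [measurable]: "\<And>n. U n \<in> borel_measurable M"
    and bounds: "\<And>n. AE x in M. 0 \<le> U n x \<and> U n x \<le> B"
    and mono: "\<And>n. AE x in M. U n x \<le> U (Suc n) x"
  obtains L where "L \<in> borel_measurable M" "\<And>x. 0 \<le> L x"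
    "AE x in M. (\<lambda>n. U n x) \<longlonglongrightarrow> L x \<and> (\<forall>n. 0 \<le> U n x \<and> U n x \<le> L x) \<and> L x \<le> B"
proof -
  define L where "L x = max 0 (lim (\<lambda>n. U n x))" for x
  have "L \<in> borel_measurable M"
    unfolding L_def by (intro borel_measurable_max borel_measurable_lim_metric) simp_all
  moreover have "AE x in M. \<forall>n. 0 \<le> U n x \<and> U n x \<le> B \<and> U n x \<le> U (Suc n) x"
    using bounds mono by (simp add: AE_all_countable)
  then have "AE x in M. (\<lambda>n. U n x) \<longlonglongrightarrow> L x \<and> (\<forall>n. 0 \<le> U n x \<and> U n x \<le> L x) \<and> L x \<le> B"
  proof eventually_elim
    case (elim x)
    have inc: "incseq (\<lambda>n. U n x)" using elim by (intro incseq_SucI) auto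
    obtain l where l: "(\<lambda>n. U n x) \<longlonglongrightarrow> l"
      using incseq_convergent[OF inc, of B] elim by blast
    have "0 \<le> l" "l \<le> B"
      using l elim by (auto intro: LIMSEQ_le_const LIMSEQ_le_const2)
    then have "L x = l" using limI[OF l] by (simp add: L_def)
    with l incseq_le[OF inc l] elim \<open>l \<le> B\<close> show ?case by auto
  qed
  ultimately show ?thesis by (intro that[of L]) (auto simp: L_def)
qed

lemma (in bounded_open_set) poisson_imp_weak_solution:
  assumes p: "poisson (\<lambda>x. lam x * f (u x) + h x) u g"
    and F: "square_integrable \<mu> (\<lambda>x. lam x * f (u x) + h x)"
  shows "weak_solution \<Omega> lam f h u"
  unfolding weak_solution_def set_integrable_iff_integrable_\<mu> set_integral_eq_integral_\<mu>
proof (intro exI[of _ g] conjI allI impI)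
  note H10 = poisson_H10[OF p]
  show "W120 \<Omega> u g" using H10 by (rule H10_imp_W120)
  fix \<phi> assume \<phi>: "test_fun \<Omega> \<phi>"
  show "integrable \<mu> (\<lambda>x. g x \<bullet> grad \<phi> x)"
    by (rule integrable_inner_square_integrable[OF H10_square_integrable(2)[OF H10]
          square_integrable_grad_test[OF \<phi>]])
  show "integrable \<mu> (\<lambda>x. (lam x * f (u x) + h x) * \<phi> x)"
    using integrable_inner_square_integrable[OF F square_integrable_test[OF \<phi>]] by simp
  show "(LINT x|\<mu>. g x \<bullet> grad \<phi> x) = (LINT x|\<mu>. (lam x * f (u x) + h x) * \<phi> x)"
    using p \<phi> by (simp add: poisson_def L2_inner_def)
qed

locale bounded_semilinear_problem = bounded_open_set \<Omega> for \<Omega> :: "'a::euclidean_space set" +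
  fixes f :: "real \<Rightarrow> real" and lam h :: "'a \<Rightarrow> real" and \<Lambda> H B :: real
  assumes f_nonneg: "\<And>s. 0 \<le> s \<Longrightarrow> 0 \<le> f s"
    and f_mono: "\<And>s t. 0 \<le> s \<Longrightarrow> s \<le> t \<Longrightarrow> f s \<le> f t"
    and f_lsc: "lsc_nonneg f"
    and lam_measurable [measurable]: "lam \<in> borel_measurable \<mu>"
    and h_measurable [measurable]: "h \<in> borel_measurable \<mu>"
    and lam_bounds: "AE x in \<mu>. 0 \<le> lam x \<and> lam x \<le> \<Lambda>"
    and h_bounds: "AE x in \<mu>. 0 \<le> h x \<and> h x \<le> H"
    and B_nonneg: "0 \<le> B"
    and B_supersolution: "(\<Lambda> * f B + H) * (slab_diam \<Omega>)\<^sup>2 / 8 \<le> B"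
begin

text \<open>Nothing is known about \<open>f\<close> at negative arguments; the positive part makes the right-hand
  side monotone and measurable.\<close>

definition rhs :: "('a \<Rightarrow> real) \<Rightarrow> 'a \<Rightarrow> real" where
  "rhs u x = lam x * f (max 0 (u x)) + h x"

definition admissible :: "('a \<Rightarrow> real) \<Rightarrow> bool" where
  "admissible u \<longleftrightarrow> u \<in> borel_measurable \<mu> \<and> (AE x in \<mu>. 0 \<le> u x \<and> u x \<le> B)"

lemma admissible_norm_le:
  assumes "admissible u"
  shows "AE x in \<mu>. norm (u x) \<le> B"
proof -
  have "AE x in \<mu>. 0 \<le> u x \<and> u x \<le> B" using assms unfolding admissible_def ..
  then show ?thesis by eventually_elim simp
qed

lemma \<Lambda>_nonneg: "0 \<le> \<Lambda>"
proof (rule essential_bound_nonneg)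
  show "AE x in \<mu>. \<bar>lam x\<bar> \<le> \<Lambda>" using lam_bounds by eventually_elim simp
qed

lemma H_nonneg: "0 \<le> H"
proof (rule essential_bound_nonneg)
  show "AE x in \<mu>. \<bar>h x\<bar> \<le> H" using h_bounds by eventually_elim simp
qed

lemma rhs_measurable:
  assumes [measurable]: "u \<in> borel_measurable \<mu>"
  shows "rhs u \<in> borel_measurable \<mu>"
proof -
  have "mono (\<lambda>s. f (max 0 s))" by (intro monoI f_mono) auto
  then have [measurable]: "(\<lambda>s. f (max 0 s)) \<in> borel_measurable borel"
    by (rule borel_measurable_mono)
  show ?thesis unfolding rhs_def by measurable
qed

lemma rhs_bounds:
  assumes "admissible u"
  shows "AE x in \<mu>. 0 \<le> rhs u x \<and> rhs u x \<le> \<Lambda> * f B + H"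
proof -
  have "AE x in \<mu>. 0 \<le> u x \<and> u x \<le> B" using assms by (simp add: admissible_def)
  then show ?thesis
    using lam_bounds h_bounds
  proof eventually_elim
    case (elim x)
    then have "lam x * f (u x) \<le> \<Lambda> * f B"
      using \<Lambda>_nonneg f_nonneg f_mono by (intro mult_mono) auto
    then show ?case using elim f_nonneg by (simp add: rhs_def)
  qed
qed

lemma rhs_norm_le:
  assumes "admissible u"
  shows "AE x in \<mu>. norm (rhs u x) \<le> \<Lambda> * f B + H"
  using rhs_bounds[OF assms] by eventually_elim simp

lemma rhs_square_integrable: "admissible u \<Longrightarrow> square_integrable \<mu> (rhs u)"
  by (rule square_integrable_bounded[OF rhs_measurable rhs_norm_le]) (simp_all add: admissible_def)

lemma rhs_mono:
  assumes "AE x in \<mu>. u x \<le> v x"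
  shows "AE x in \<mu>. rhs u x \<le> rhs v x"
  using assms lam_bounds
  by eventually_elim (auto simp: rhs_def intro!: mult_left_mono f_mono)

lemma poisson_rhs_admissible:
  assumes "poisson (rhs w) u g" "admissible w"
  shows "admissible u"
proof -
  note rhs = rhs_square_integrable[OF assms(2)] rhs_bounds[OF assms(2)]
  have "AE x in \<mu>. 0 \<le> u x"
    using rhs(2) by (intro poisson_nonneg[OF assms(1) rhs(1)]) (auto elim!: eventually_mono)
  moreover have "AE x in \<mu>. u x \<le> (\<Lambda> * f B + H) * (slab_diam \<Omega>)\<^sup>2 / 8"
    using rhs(2) \<Lambda>_nonneg H_nonneg f_nonneg[OF B_nonneg]
    by (intro poisson_slab_diam_bound[OF assms(1) rhs(1)]) (auto elim!: eventually_mono)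
  ultimately have "AE x in \<mu>. 0 \<le> u x \<and> u x \<le> B"
    by eventually_elim (use B_supersolution in linarith)
  then show ?thesis
    using H10_square_integrable(1)[OF poisson_H10[OF assms(1)]]
    by (simp add: admissible_def square_integrable_def)
qed

lemma iterates_exist:
  obtains U where "U 0 = (\<lambda>x. 0)" "\<And>n. admissible (U n)"
    "\<And>n. \<exists>g. poisson (rhs (U n)) (U (Suc n)) g"
proof -
  have "\<exists>U. \<forall>n. (admissible (U n) \<and> (n = 0 \<longrightarrow> U n = (\<lambda>x. 0)))
      \<and> (\<exists>g. poisson (rhs (U n)) (U (Suc n)) g)"
  proof (rule dependent_nat_choice)
    show "\<exists>w. admissible w \<and> (0 = 0 \<longrightarrow> w = (\<lambda>x. 0))"
      using B_nonneg by (simp add: admissible_def)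
    fix w and n :: nat assume w: "admissible w \<and> (n = 0 \<longrightarrow> w = (\<lambda>x. 0))"
    then obtain u g where "poisson (rhs w) u g"
      using poisson_exists[OF rhs_square_integrable] by blast
    then show "\<exists>u. (admissible u \<and> (Suc n = 0 \<longrightarrow> u = (\<lambda>x. 0))) \<and> (\<exists>g. poisson (rhs w) u g)"
      using poisson_rhs_admissible w by blast
  qed
  then show ?thesis using that by blast
qed

lemma iterates_mono:
  assumes "U 0 = (\<lambda>x. 0)" and U: "\<And>n. admissible (U n)"
    "\<And>n. \<exists>g. poisson (rhs (U n)) (U (Suc n)) g"
  shows "AE x in \<mu>. U n x \<le> U (Suc n) x"
proof (induction n)
  case 0
  show ?case using U(1)[of 1] assms(1) by (auto simp: admissible_def elim!: eventually_mono)
next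
  case (Suc n)
  obtain g g' where "poisson (rhs (U n)) (U (Suc n)) g"
    "poisson (rhs (U (Suc n))) (U (Suc (Suc n))) g'"
    using U(2) by metis
  then show ?case
    using rhs_square_integrable[OF U(1)] rhs_square_integrable[OF U(1)] rhs_mono[OF Suc]
    by (rule poisson_mono)
qed

lemma rhs_LIMSEQ:
  assumes "AE x in \<mu>. (\<lambda>n. U n x) \<longlonglongrightarrow> L x \<and> (\<forall>n. 0 \<le> U n x \<and> U n x \<le> L x)"
  shows "AE x in \<mu>. (\<lambda>n. rhs (U n) x) \<longlonglongrightarrow> rhs L x"
  using assms
proof eventually_elim
  case (elim x)
  then have "0 \<le> U 0 x" "U 0 x \<le> L x" by auto
  then have "0 \<le> L x" by (rule order_trans)
  moreover have "(\<lambda>n. f (U n x)) \<longlonglongrightarrow> f (L x)"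
    by (rule lsc_nonneg_mono_LIMSEQ[OF f_mono f_lsc]) (use elim in auto)
  then have "(\<lambda>n. lam x * f (U n x) + h x) \<longlonglongrightarrow> lam x * f (L x) + h x"
    by (intro tendsto_intros)
  ultimately show ?case using elim by (simp add: rhs_def)
qed

lemma bounded_solution_exists:
  obtains u where "weak_solution \<Omega> lam f h u" "u \<in> borel_measurable \<mu>" "\<And>x. 0 \<le> u x"
    "AE x in \<mu>. u x \<le> B"
proof -
  obtain U where U: "U 0 = (\<lambda>x. 0)" "\<And>n. admissible (U n)"
    "\<And>n. \<exists>g. poisson (rhs (U n)) (U (Suc n)) g"
    using iterates_exist by blast
  obtain L where L: "L \<in> borel_measurable \<mu>" "\<And>x. 0 \<le> L x"
    "AE x in \<mu>. (\<lambda>n. U n x) \<longlonglongrightarrow> L x \<and> (\<forall>n. 0 \<le> U n x \<and> U n x \<le> L x) \<and> L x \<le> B"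
    using AE_incseq_bounded_limit[of U \<mu> B] iterates_mono[OF U] U(2)
    unfolding admissible_def by blast
  have L_le: "AE x in \<mu>. L x \<le> B" using L(3) by eventually_elim blast
  then have "admissible L" using L(1,2) by (simp add: admissible_def)
  have U_meas: "U n \<in> borel_measurable \<mu>" for n using U(2) by (simp add: admissible_def)
  have rhs_lim: "L2_tendsto \<mu> (\<lambda>n. rhs (U n)) (rhs L)"
  proof (rule L2_tendsto_dominated[OF rhs_measurable[OF U_meas] rhs_measurable[OF L(1)]
        rhs_norm_le[OF U(2)] rhs_LIMSEQ])
    show "AE x in \<mu>. (\<lambda>n. U n x) \<longlonglongrightarrow> L x \<and> (\<forall>n. 0 \<le> U n x \<and> U n x \<le> L x)"
      using L(3) by eventually_elim blast
  qed
  have U_lim: "L2_tendsto \<mu> (\<lambda>n. U (Suc n)) L"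
  proof (rule L2_tendsto_dominated[OF U_meas L(1) admissible_norm_le[OF U(2)]])
    show "AE x in \<mu>. (\<lambda>n. U (Suc n) x) \<longlonglongrightarrow> L x"
      using L(3) by eventually_elim (simp add: filterlim_sequentially_Suc[of "\<lambda>n. U n _"])
  qed
  obtain G where "\<And>n. poisson (rhs (U n)) (U (Suc n)) (G n)" using U(3) by metis
  then obtain g where g: "poisson (rhs L) L g" using rhs_lim U_lim by (rule poisson_limit)
  have "rhs L = (\<lambda>x. lam x * f (L x) + h x)" using L(2) by (simp add: rhs_def fun_eq_iff)
  then have "weak_solution \<Omega> lam f h L"
    using g rhs_square_integrable[OF \<open>admissible L\<close>] by (intro poisson_imp_weak_solution) simp_all
  then show ?thesis using L(1,2) L_le by (rule that)
qed

end

lemma (in bounded_open_set) semilinear_solution_exists: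
  fixes f :: "real \<Rightarrow> real"
  assumes f: "\<And>s. s \<ge> 0 \<Longrightarrow> f s \<ge> 0" "\<And>s t. 0 \<le> s \<Longrightarrow> s \<le> t \<Longrightarrow> f s \<le> f t" "lsc_nonneg f"
    and Linf: "Linf_on \<Omega> lam" "Linf_on \<Omega> h"
    and nonneg: "AE x in lebesgue. x \<in> \<Omega> \<longrightarrow> 0 \<le> lam x" "AE x in lebesgue. x \<in> \<Omega> \<longrightarrow> 0 \<le> h x"
    and B: "0 \<le> B" "f B \<le> m"
      "(Linf_norm \<Omega> lam * m + Linf_norm \<Omega> h) * ((slab_diam \<Omega>)\<^sup>2 / 8) \<le> B"
  shows "\<exists>u. weak_solution \<Omega> lam f h u \<and> Linf_on \<Omega> u
    \<and> (AE x in lebesgue. x \<in> \<Omega> \<longrightarrow> 0 \<le> u x) \<and> Linf_norm \<Omega> u \<le> B"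
proof -
  have bounds: "AE x in \<mu>. 0 \<le> v x \<and> v x \<le> Linf_norm \<Omega> v"
    if "Linf_on \<Omega> v" "AE x in \<mu>. 0 \<le> v x" for v
    using that(2) AE_le_Linf_norm[OF that(1)] by eventually_elim simp
  have "(Linf_norm \<Omega> lam * f B + Linf_norm \<Omega> h) * ((slab_diam \<Omega>)\<^sup>2 / 8)
      \<le> (Linf_norm \<Omega> lam * m + Linf_norm \<Omega> h) * ((slab_diam \<Omega>)\<^sup>2 / 8)"
    using B(2) Linf_norm_nonneg[OF Linf(1)]
    by (intro mult_right_mono add_right_mono mult_left_mono) simp_all
  also note B(3)
  finally interpret bounded_semilinear_problem \<Omega> f lam h "Linf_norm \<Omega> lam" "Linf_norm \<Omega> h" B
    using assms bounds[OF Linf(1) nonneg(1)[folded AE_\<mu>_iff]]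
      bounds[OF Linf(2) nonneg(2)[folded AE_\<mu>_iff]]
    by unfold_locales (auto simp: Linf_on_def)
  obtain u where u: "weak_solution \<Omega> lam f h u" "u \<in> borel_measurable \<mu>" "\<And>x. 0 \<le> u x"
    "AE x in \<mu>. u x \<le> B"
    using bounded_solution_exists by blast
  then have abs_u: "AE x in \<mu>. \<bar>u x\<bar> \<le> B" by simp
  then have "Linf_on \<Omega> u" using u(2) by (auto simp: Linf_on_def AE_\<mu>_iff)
  then show ?thesis using u Linf_norm_le[OF abs_u] by (intro exI[of _ u]) simp
qed

lemma sublinear_bound_exists:
  fixes p q r :: real
  assumes "p < 1" "0 \<le> q" "0 \<le> r"
  obtains B where "B \<ge> 1" "q * B powr p + r \<le> B"
proof -
  define B where "B = max 1 (max (2 * r) ((2 * q) powr (1 / (1 - p))))"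
  have B: "B \<ge> 1" "B \<ge> 2 * r" "B \<ge> (2 * q) powr (1 / (1 - p))" by (auto simp: B_def)
  have "2 * q \<le> ((2 * q) powr (1 / (1 - p))) powr (1 - p)"
    using assms by (simp add: powr_powr)
  also have "\<dots> \<le> B powr (1 - p)"
    using B assms by (intro powr_mono2) auto
  finally have "2 * q * B powr p \<le> B powr (1 - p) * B powr p"
    by (intro mult_right_mono) auto
  also have "\<dots> = B" using B by (simp flip: powr_add)
  finally show ?thesis using B by (intro that[of B]) auto
qed

theorem theorem3p3:
  fixes \<Omega> :: "'a::euclidean_space set"
    and f :: "real \<Rightarrow> real" and lam h :: "'a \<Rightarrow> real" and K p :: real
  assumes f_nonneg: "\<And>s. s \<ge> 0 \<Longrightarrow> f s \<ge> 0"
    and f_mono: "\<And>s t. 0 \<le> s \<Longrightarrow> s \<le> t \<Longrightarrow> f s \<le> f t"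
    and f_lsc: "lsc_nonneg f"
    and K_pos: "K > 0" and p_pos: "p > 0"
    and f_growth: "\<And>s. s \<ge> 0 \<Longrightarrow> f s \<le> K * s powr p"
    and \<Omega>_open: "open \<Omega>" and \<Omega>_conn: "connected \<Omega>" and \<Omega>_ne: "\<Omega> \<noteq> {}"
    and \<Omega>_bdd: "bounded \<Omega>" and \<Omega>_C11: "C11_domain \<Omega>"
    and h_Linf: "Linf_on \<Omega> h" and lam_Linf: "Linf_on \<Omega> lam"
    and h_nonneg: "AE x in lebesgue. x \<in> \<Omega> \<longrightarrow> h x \<ge> 0"
    and lam_nonneg: "AE x in lebesgue. x \<in> \<Omega> \<longrightarrow> lam x \<ge> 0"
  shows
    "(p < 1 \<longrightarrow>
        (\<exists>u. weak_solution \<Omega> lam f h u \<and> Linf_on \<Omega> u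
             \<and> (AE x in lebesgue. x \<in> \<Omega> \<longrightarrow> u x \<ge> 0)))
   \<and> (p \<ge> 1 \<and> (slab_diam \<Omega>)\<^sup>2 / 8 * K * Linf_norm \<Omega> lam \<le> 1/2
        \<and> Linf_norm \<Omega> h \<le> Linf_norm \<Omega> lam * K \<longrightarrow>
        (\<exists>u. weak_solution \<Omega> lam f h u \<and> Linf_on \<Omega> u
             \<and> (AE x in lebesgue. x \<in> \<Omega> \<longrightarrow> u x \<ge> 0)
             \<and> Linf_norm \<Omega> u \<le> 1))"
proof -
  interpret bounded_open_set \<Omega> using \<Omega>_open \<Omega>_bdd \<Omega>_ne by unfold_locales
  define \<Lambda> H c where "\<Lambda> = Linf_norm \<Omega> lam" and "H = Linf_norm \<Omega> h" and "c = (slab_diam \<Omega>)\<^sup>2 / 8"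
  have nonneg: "0 \<le> \<Lambda>" "0 \<le> H" "0 \<le> c"
    using Linf_norm_nonneg lam_Linf h_Linf by (auto simp: \<Lambda>_def H_def c_def)
  have solution_exists: "\<exists>u. weak_solution \<Omega> lam f h u \<and> Linf_on \<Omega> u
      \<and> (AE x in lebesgue. x \<in> \<Omega> \<longrightarrow> u x \<ge> 0) \<and> Linf_norm \<Omega> u \<le> B"
    if "0 \<le> B" "f B \<le> m" "(\<Lambda> * m + H) * c \<le> B" for B m
    by (rule semilinear_solution_exists[OF f_nonneg f_mono f_lsc lam_Linf h_Linf
          lam_nonneg h_nonneg that[unfolded \<Lambda>_def H_def c_def]])
  show ?thesis
  proof (intro conjI impI)
    assume "p < 1"
    then obtain B where "B \<ge> 1" "\<Lambda> * K * c * B powr p + H * c \<le> B"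
      using sublinear_bound_exists[of p "\<Lambda> * K * c" "H * c"] nonneg K_pos by auto
    then have B: "0 \<le> B" "(\<Lambda> * (K * B powr p) + H) * c \<le> B" by (simp_all add: algebra_simps)
    show "\<exists>u. weak_solution \<Omega> lam f h u \<and> Linf_on \<Omega> u \<and> (AE x in lebesgue. x \<in> \<Omega> \<longrightarrow> u x \<ge> 0)"
      using solution_exists[OF B(1) f_growth[OF B(1)] B(2)] by blast
  next
    assume small: "p \<ge> 1 \<and> (slab_diam \<Omega>)\<^sup>2 / 8 * K * Linf_norm \<Omega> lam \<le> 1/2
        \<and> Linf_norm \<Omega> h \<le> Linf_norm \<Omega> lam * K"
    then have "(\<Lambda> * K + H) * c \<le> (\<Lambda> * K + \<Lambda> * K) * c"
      using nonneg by (intro mult_right_mono) (simp_all add: \<Lambda>_def H_def mult.commute)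
    also have "\<dots> \<le> 1" using small by (simp add: \<Lambda>_def c_def algebra_simps)
    finally show "\<exists>u. weak_solution \<Omega> lam f h u \<and> Linf_on \<Omega> u
        \<and> (AE x in lebesgue. x \<in> \<Omega> \<longrightarrow> u x \<ge> 0) \<and> Linf_norm \<Omega> u \<le> 1"
      using solution_exists[of 1 K] f_growth[of 1] by simp
  qed
qed

end
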